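(* The family of Riemann surfaces obtained from the plumbing construction does not necessarily give local coordinates on Teichmüller space. That is, there exist $g,n$, a maximally degenerate Riemann surface $X_0$ of genus $g$ with $n$ punctures, and a choice of local coordinates $z_i,w_i$ ($i=1,\dots,m$, $m=3g-3+n$) at the double points of $X_0$ satisfying the disjointness property (DIS), such that the holomorphic map $\alpha:B\to\mathfrak{M}_{g,n}$, $t\mapsto [X_t]$, classifying the associated plumbing family over $B=(D\setminus\{0\})^m$ is not étale (i.e. is not a local isomorphism) at some point $t\in B$.
   Context: Let $g,n\ge 0$ be integers with $2g-2+n>0$ and $m=3g-3+n\ge 1$. A maximally degenerate Riemann surface $X_0$ of genus $g$ with $n$ punctures is a connected nodal Riemann surface whose irreducible components are $d=2g-2+n$ triply-punctured Riemann spheres $S_1,\dots,S_d$; some pairs of punctures are glued together to form $m=3g-3+n$ double points (nodes), and the remaining $n$ punctures are the (labelled) punctures of $X_0$. Let $D=\{z\in\mathbb{C} : |z|<1\}$. A choice of local coordinates at the double points is a choice of $2m$ holomorphic open embeddings $z_i,w_i$ ($i=1,\dots,m$) of $D$, each into the component sphere of $X_0$ with the relevant puncture filled in, such that $z_i(0)$ and $w_i(0)$ are the two punctures glued to form the $i$-th double point of $X_0$ (so the images contain no puncture of $X_0$). The same letters $z_i,w_i$ also denote the resulting local coordinate functions. Disjointness property (DIS): the images in $X_0$ of the $2m$ embeddings $z_i,w_j$ have no intersection, except for the double points $z_i(0)=w_i(0)$. Plumbing family: for $t=(t_1,\dots,t_m)\in D^m$, the (possibly nodal) Riemann surface $X_t$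 of genus $g$ with $n$ punctures is obtained from $X_0$ by replacing, for each $i$, the neighborhood of the $i$-th double point given by $z_iw_i=0$ with the surface given by $z_iw_i=t_i$. When all $t_i\neq 0$, this means: remove the closed discs $\{|z_i|\le|t_i|\}$ and $\{|w_i|\le|t_i|\}$ from the corresponding spheres and glue the annuli $\{|t_i|<|z_i|<1\}$ and $\{|t_i|<|w_i|<1\}$ by the identification $z_iw_i=t_i$. These surfaces form a flat holomorphic family $\pi:\mathfrak{X}\to D^m$ with fibers $X_t$, and $X_t$ is non-singular iff all $t_i\neq 0$. Hence, over $B=(D\setminus\{0\})^m$, the family is classified by a holomorphic map $\alpha:B\to\mathfrak{M}_{g,n}$ to the moduli stack (complex orbifold) of non-singular Riemann surfaces of genus $g$ with $n$ punctures. The map $\alpha$ is étale at $t$ if it is a local isomorphism at $t$; equivalently, a local lift of $\alpha$ near $t$ to the Teichmüller space $\mathcal{T}_{g,n}$ is a local biholomorphism at $t$. *)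

theory Defs
  imports "HOL-Complex_Analysis.Complex_Analysis" "HOL-Homology.Homology"
begin

section \<open>The space \<open>C^k\<close> and holomorphic functions of several variables\<close>

text \<open>The dimension \<open>k\<close> has to be quantified over inside formulas, so \<open>C^k\<close> is
  the set of sequences vanishing from index \<open>k\<close> on, with the topology induced by the product
  topology of the function type (which is the usual one).\<close>

type_synonym cvec = "nat \<Rightarrow> complex"

definition Cn :: "nat \<Rightarrow> cvec set" where
  "Cn k = {s. \<forall>i\<ge>k. s i = 0}"

text \<open>Holomorphic means continuous and holomorphic in each variable separately (as in Osgood's
  lemma). The set \<open>S\<close> is meant to be open in \<open>C^k\<close>, and \<open>W\<close> open in
  \<open>C \<times> C^k\<close>.\<close>

definition holo :: "nat \<Rightarrow> cvec set \<Rightarrow> (cvec \<Rightarrow> complex) \<Rightarrow> bool" where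
  "holo k S f \<longleftrightarrow> continuous_on S f \<and>
     (\<forall>s\<in>S. \<forall>i<k. (\<lambda>u. f (s(i := u))) field_differentiable at (s i))"

definition holo_prod :: "nat \<Rightarrow> (complex \<times> cvec) set \<Rightarrow> (complex \<times> cvec \<Rightarrow> complex) \<Rightarrow> bool" where
  "holo_prod k W f \<longleftrightarrow> continuous_on W f \<and>
     (\<forall>(x, s)\<in>W. (\<lambda>u. f (u, s)) field_differentiable at x \<and>
        (\<forall>i<k. (\<lambda>u. f (x, s(i := u))) field_differentiable at (s i)))"


section \<open>Families of pointed Riemann surfaces: the stack \<open>M_{g,n}\<close>\<close>

text \<open>A family over an open subset \<open>base\<close> of \<open>C^bdim\<close>: total space \<open>points\<close>,
  projection \<open>proj\<close>, sections \<open>mark i\<close>, and charts \<open>(U, \<zeta>)\<close> where \<open>\<zeta>\<close> is a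
  fibre coordinate on \<open>U\<close>, so that \<open>(\<zeta>, proj)\<close> are complex coordinates of the total
  space. (By the implicit function theorem every holomorphic submersion with one-dimensional fibres
  has an atlas of this form.)\<close>

record 'a fam =
  bdim :: nat
  base :: "cvec set"
  points :: "'a set"
  proj :: "'a \<Rightarrow> cvec"
  charts :: "('a set \<times> ('a \<Rightarrow> complex)) set"
  mark :: "nat \<Rightarrow> cvec \<Rightarrow> 'a"

definition fibre :: "'a fam \<Rightarrow> cvec \<Rightarrow> 'a set" where
  "fibre Y s = {y \<in> points Y. proj Y y = s}"

definition coord :: "'a fam \<Rightarrow> ('a \<Rightarrow> complex) \<Rightarrow> 'a \<Rightarrow> complex \<times> cvec" where
  "coord Y \<zeta> y = (\<zeta> y, proj Y y)"

definition fam_top :: "'a fam \<Rightarrow> 'a topology" where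
  "fam_top Y = topology_generated_by
     {{y \<in> U. coord Y \<zeta> y \<in> W} | U \<zeta> W. (U, \<zeta>) \<in> charts Y \<and> open W}"

definition rel_open :: "nat \<Rightarrow> (complex \<times> cvec) set \<Rightarrow> bool" where
  "rel_open k W \<longleftrightarrow> openin (top_of_set (UNIV \<times> Cn k)) W"

definition holomorphic_atlas :: "'a fam \<Rightarrow> bool" where
  "holomorphic_atlas Y \<longleftrightarrow>
     (\<Union>(U, \<zeta>)\<in>charts Y. U) = points Y \<and>
     (\<forall>(U, \<zeta>)\<in>charts Y. inj_on (coord Y \<zeta>) U \<and> rel_open (bdim Y) (coord Y \<zeta> ` U)) \<and>
     (\<forall>(U, \<zeta>)\<in>charts Y. \<forall>(V, \<xi>)\<in>charts Y.
        rel_open (bdim Y) (coord Y \<zeta> ` (U \<inter> V)) \<and>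
        holo_prod (bdim Y) (coord Y \<zeta> ` (U \<inter> V)) (\<lambda>x. \<xi> (inv_into U (coord Y \<zeta>) x)))"

definition holomorphic_section :: "'a fam \<Rightarrow> (cvec \<Rightarrow> 'a) \<Rightarrow> bool" where
  "holomorphic_section Y \<sigma> \<longleftrightarrow>
     (\<forall>s\<in>base Y. \<sigma> s \<in> fibre Y s) \<and>
     (\<forall>(U, \<zeta>)\<in>charts Y.
        openin (top_of_set (Cn (bdim Y))) {s \<in> base Y. \<sigma> s \<in> U} \<and>
        holo (bdim Y) {s \<in> base Y. \<sigma> s \<in> U} (\<lambda>s. \<zeta> (\<sigma> s)))"

definition has_genus :: "'a topology \<Rightarrow> nat \<Rightarrow> bool" where
  "has_genus T g \<longleftrightarrow> homology_group 1 T \<cong> free_Abelian_group {..<2 * g}"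

text \<open>An object of \<open>M_{g,n}\<close> over the complex manifold \<open>base Y\<close>: a proper holomorphic
  family of connected Riemann surfaces of genus \<open>g\<close> with \<open>n\<close> labelled disjoint sections.
  A surface with punctures is recorded as the compact surface with the punctures filled in and
  marked.\<close>

definition family :: "nat \<Rightarrow> nat \<Rightarrow> 'a fam \<Rightarrow> bool" where
  "family g n Y \<longleftrightarrow>
     openin (top_of_set (Cn (bdim Y))) (base Y) \<and>
     proj Y ` points Y \<subseteq> base Y \<and>
     holomorphic_atlas Y \<and>
     Hausdorff_space (fam_top Y) \<and>
     proper_map (fam_top Y) (top_of_set (base Y)) (proj Y) \<and>
     (\<forall>s\<in>base Y. fibre Y s \<noteq> {} \<and>
        connected_space (subtopology (fam_top Y) (fibre Y s)) \<and>
        has_genus (subtopology (fam_top Y) (fibre Y s)) g) \<and>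
     (\<forall>i<n. holomorphic_section Y (mark Y i)) \<and>
     (\<forall>s\<in>base Y. inj_on (\<lambda>i. mark Y i s) {..<n})"

text \<open>An arrow of \<open>M_{g,n}\<close> from the restriction of \<open>Y\<close> to \<open>S \<subseteq> base Y\<close> to
  \<open>X\<close>, lying over \<open>f\<close> from \<open>S\<close> to \<open>base X\<close>: a holomorphic map \<open>\<Phi>\<close> of total spaces
  over \<open>f\<close> that is bijective on fibres and respects the sections. This is the same as an
  isomorphism over \<open>S\<close> of \<open>Y\<close> with the pullback of \<open>X\<close> along \<open>f\<close>.\<close>

definition family_arrow ::
    "nat \<Rightarrow> 'a fam \<Rightarrow> cvec set \<Rightarrow> 'b fam \<Rightarrow> (cvec \<Rightarrow> cvec) \<Rightarrow> ('a \<Rightarrow> 'b) \<Rightarrow> bool" where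
  "family_arrow n Y S X f \<Phi> \<longleftrightarrow>
     f ` S \<subseteq> base X \<and>
     (\<forall>i<bdim X. holo (bdim Y) S (\<lambda>s. f s i)) \<and>
     (\<forall>s\<in>S. bij_betw \<Phi> (fibre Y s) (fibre X (f s)) \<and> (\<forall>i<n. \<Phi> (mark Y i s) = mark X i (f s))) \<and>
     (\<forall>(U, \<zeta>)\<in>charts Y. \<forall>(V, \<xi>)\<in>charts X.
        let A = {y \<in> U. proj Y y \<in> S \<and> \<Phi> y \<in> V} in
          rel_open (bdim Y) (coord Y \<zeta> ` A) \<and>
          holo_prod (bdim Y) (coord Y \<zeta> ` A) (\<lambda>x. \<xi> (\<Phi> (inv_into U (coord Y \<zeta>) x))))"

definition fibre_iso :: "nat \<Rightarrow> 'a fam \<Rightarrow> cvec \<Rightarrow> 'b fam \<Rightarrow> cvec \<Rightarrow> ('a \<Rightarrow> 'b) \<Rightarrow> bool" where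
  "fibre_iso n Y s X t \<phi> \<longleftrightarrow>
     bij_betw \<phi> (fibre Y s) (fibre X t) \<and>
     (\<forall>i<n. \<phi> (mark Y i s) = mark X i t) \<and>
     (\<forall>(U, \<zeta>)\<in>charts Y. \<forall>(V, \<xi>)\<in>charts X.
        let A = {y \<in> fibre Y s \<inter> U. \<phi> y \<in> V} in
          open (\<zeta> ` A) \<and> (\<lambda>u. \<xi> (\<phi> (inv_into A \<zeta> u))) holomorphic_on \<zeta> ` A)"


section \<open>Local isomorphisms to the moduli stack\<close>

text \<open>A family \<open>X\<close> is the same as a morphism \<open>\<alpha>\<close> from \<open>base X\<close> to \<open>M_{g,n}\<close>. A morphism
  from \<open>S\<close> to \<open>M_{g,n}\<close> is a family \<open>Y\<close> over \<open>S\<close>. A point of the fibre product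
  \<open>base X \<times>_{M_{g,n}} S\<close> is a triple \<open>(t, s, \<phi>)\<close> with \<open>\<phi>\<close> an isomorphism of the fibres
  of \<open>Y\<close> at \<open>s\<close> and of \<open>X\<close> at \<open>t\<close>, and a section of the fibre product over
  \<open>S' \<subseteq> S\<close> is a pair \<open>(f, \<Phi>)\<close> with \<open>f\<close> holomorphic from \<open>S'\<close> to \<open>base X\<close> and
  \<open>\<Phi>\<close> an isomorphism of the restriction of \<open>Y\<close> with the pullback of \<open>X\<close> along \<open>f\<close>.
  The following predicate describes the sections through the point \<open>(t, s, \<phi>)\<close>.\<close>

definition local_section ::
    "nat \<Rightarrow> 'a fam \<Rightarrow> cvec \<Rightarrow> 'b fam \<Rightarrow> cvec \<Rightarrow> ('a \<Rightarrow> 'b) \<Rightarrow>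
     cvec set \<Rightarrow> (cvec \<Rightarrow> cvec) \<Rightarrow> ('a \<Rightarrow> 'b) \<Rightarrow> bool" where
  "local_section n Y s X t \<phi> S f \<Phi> \<longleftrightarrow>
     openin (top_of_set (base Y)) S \<and> s \<in> S \<and>
     family_arrow n Y S X f \<Phi> \<and>
     f s = t \<and> (\<forall>y\<in>fibre Y s. \<Phi> y = \<phi> y)"

text \<open>\<open>\<alpha>\<close> is etale (a local isomorphism) at \<open>t\<close> iff for every \<open>Y\<close> over every \<open>S\<close> the
  projection \<open>base X \<times>_{M_{g,n}} S \<rightarrow> S\<close> is a local isomorphism at all points
  \<open>(t, s, \<phi>)\<close>. Since this is required for all \<open>S\<close> (hence stably under base change), it
  says, by the functor of points of the fibre product, that through \<open>(t, s, \<phi>)\<close> there is exactly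
  one germ of a section. The condition is local on \<open>S\<close>, so
  \<open>S\<close> may be taken open in some \<open>C^k\<close>. The points of \<open>Y\<close> are taken from the type of
  points of \<open>X\<close>, which loses no generality when that type has at least the cardinality of the
  continuum, as for the plumbing families below.\<close>

definition etale_at :: "nat \<Rightarrow> nat \<Rightarrow> 'a fam \<Rightarrow> cvec \<Rightarrow> bool" where
  "etale_at g n X t \<longleftrightarrow>
     (\<forall>(Y :: 'a fam) s \<phi>. family g n Y \<and> s \<in> base Y \<and> fibre_iso n Y s X t \<phi> \<longrightarrow>
        (\<exists>S f \<Phi>. local_section n Y s X t \<phi> S f \<Phi>) \<and>
        (\<forall>S1 f1 \<Phi>1 S2 f2 \<Phi>2.
           local_section n Y s X t \<phi> S1 f1 \<Phi>1 \<and> local_section n Y s X t \<phi> S2 f2 \<Phi>2 \<longrightarrow>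
           (\<exists>S. openin (top_of_set (base Y)) S \<and> s \<in> S \<and> S \<subseteq> S1 \<inter> S2 \<and>
              (\<forall>r\<in>S. f1 r = f2 r \<and> (\<forall>y\<in>fibre Y r. \<Phi>1 y = \<Phi>2 y)))))"


section \<open>Maximally degenerate surfaces and local coordinates at the double points\<close>

text \<open>The Riemann sphere; \<open>None\<close> is the point at infinity.\<close>

type_synonym sphere = "complex option"

definition sphere_charts :: "(sphere set \<times> (sphere \<Rightarrow> complex)) set" where
  "sphere_charts = {(- {None}, the), (- {Some 0}, case_option 0 inverse)}"

text \<open>\<open>(k, x)\<close> is the point \<open>x\<close> of the \<open>k\<close>-th component sphere. The \<open>i\<close>-th double point
  arises by gluing the punctures \<open>node1 X0 i\<close> and \<open>node2 X0 i\<close>; \<open>leg X0 j\<close> is the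
  \<open>j\<close>-th puncture of the nodal surface.\<close>

type_synonym cpoint = "nat \<times> sphere"

record nodal_surface =
  node1 :: "nat \<Rightarrow> cpoint"
  node2 :: "nat \<Rightarrow> cpoint"
  leg :: "nat \<Rightarrow> cpoint"

definition num_comps :: "nat \<Rightarrow> nat \<Rightarrow> nat" where
  "num_comps g n = 2 * g + n - 2"

definition num_nodes :: "nat \<Rightarrow> nat \<Rightarrow> nat" where
  "num_nodes g n = 3 * g + n - 3"

definition special_points :: "nat \<Rightarrow> nat \<Rightarrow> nodal_surface \<Rightarrow> cpoint list" where
  "special_points g n X0 =
     map (node1 X0) [0..<num_nodes g n] @ map (node2 X0) [0..<num_nodes g n] @ map (leg X0) [0..<n]"

definition adjacent :: "nat \<Rightarrow> nat \<Rightarrow> nodal_surface \<Rightarrow> (nat \<times> nat) set" where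
  "adjacent g n X0 = {(fst (node1 X0 i), fst (node2 X0 i)) | i. i < num_nodes g n}"

definition maximally_degenerate :: "nat \<Rightarrow> nat \<Rightarrow> nodal_surface \<Rightarrow> bool" where
  "maximally_degenerate g n X0 \<longleftrightarrow>
     2 * g + n > 2 \<and> 3 * g + n \<ge> 4 \<and>
     distinct (special_points g n X0) \<and>
     (\<forall>p\<in>set (special_points g n X0). fst p < num_comps g n) \<and>
     (\<forall>k<num_comps g n. card {p \<in> set (special_points g n X0). fst p = k} = 3) \<and>
     (\<forall>a<num_comps g n. \<forall>b<num_comps g n. (a, b) \<in> (adjacent g n X0 \<union> (adjacent g n X0)\<inverse>)\<^sup>*)"

definition unit_disc :: "complex set" where
  "unit_disc = {u. norm u < 1}"

text \<open>\<open>e\<close> is a holomorphic open embedding of the unit disc into the component containing the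
  puncture \<open>p\<close>, sending \<open>0\<close> to \<open>p\<close> and avoiding all other punctures in \<open>P\<close>.\<close>

definition disc_embedding :: "cpoint set \<Rightarrow> cpoint \<Rightarrow> (complex \<Rightarrow> cpoint) \<Rightarrow> bool" where
  "disc_embedding P p e \<longleftrightarrow>
     e 0 = p \<and> (\<forall>u\<in>unit_disc. fst (e u) = fst p) \<and> inj_on e unit_disc \<and>
     (\<forall>(V, \<zeta>)\<in>sphere_charts.
        open {u \<in> unit_disc. snd (e u) \<in> V} \<and>
        (\<lambda>u. \<zeta> (snd (e u))) holomorphic_on {u \<in> unit_disc. snd (e u) \<in> V}) \<and>
     e ` unit_disc \<inter> P \<subseteq> {p}"

definition local_coordinates ::
    "nat \<Rightarrow> nat \<Rightarrow> nodal_surface \<Rightarrow> (nat \<Rightarrow> complex \<Rightarrow> cpoint) \<Rightarrow> (nat \<Rightarrow> complex \<Rightarrow> cpoint) \<Rightarrow> bool" where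
  "local_coordinates g n X0 z w \<longleftrightarrow>
     (\<forall>i<num_nodes g n.
        disc_embedding (set (special_points g n X0)) (node1 X0 i) (z i) \<and>
        disc_embedding (set (special_points g n X0)) (node2 X0 i) (w i))"

text \<open>The images are compared before the punctures are glued, where \<open>z i 0\<close> and \<open>w i 0\<close> are
  still different points. As an image contains no puncture but its own, disjointness there means
  that in the nodal surface the images meet only at the double points \<open>z i 0 = w i 0\<close>.\<close>

definition disjointness_property ::
    "nat \<Rightarrow> nat \<Rightarrow> (nat \<Rightarrow> complex \<Rightarrow> cpoint) \<Rightarrow> (nat \<Rightarrow> complex \<Rightarrow> cpoint) \<Rightarrow> bool" where
  "disjointness_property g n z w \<longleftrightarrow>
     (\<forall>i<num_nodes g n. \<forall>j<num_nodes g n.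
        (i \<noteq> j \<longrightarrow> z i ` unit_disc \<inter> z j ` unit_disc = {}) \<and>
        (i \<noteq> j \<longrightarrow> w i ` unit_disc \<inter> w j ` unit_disc = {}) \<and>
        z i ` unit_disc \<inter> w j ` unit_disc = {})"


section \<open>The plumbing family over \<open>(D - {0})^m\<close>\<close>

definition punctured_polydisc :: "nat \<Rightarrow> cvec set" where
  "punctured_polydisc m = {t \<in> Cn m. \<forall>i<m. t i \<noteq> 0 \<and> norm (t i) < 1}"

type_synonym tpoint = "cvec \<times> cpoint"

definition plumb_pieces ::
    "nat \<Rightarrow> nat \<Rightarrow> (nat \<Rightarrow> complex \<Rightarrow> cpoint) \<Rightarrow> (nat \<Rightarrow> complex \<Rightarrow> cpoint) \<Rightarrow> tpoint set" where
  "plumb_pieces g n z w =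
     {(t, p). t \<in> punctured_polydisc (num_nodes g n) \<and> fst p < num_comps g n \<and>
        (\<forall>i<num_nodes g n. p \<notin> z i ` {u. norm u \<le> norm (t i)} \<and> p \<notin> w i ` {u. norm u \<le> norm (t i)})}"

definition plumb_rel ::
    "nat \<Rightarrow> nat \<Rightarrow> (nat \<Rightarrow> complex \<Rightarrow> cpoint) \<Rightarrow> (nat \<Rightarrow> complex \<Rightarrow> cpoint) \<Rightarrow> (tpoint \<times> tpoint) set" where
  "plumb_rel g n z w =
     {((t, z i u), (t, w i v)) | t i u v.
        t \<in> punctured_polydisc (num_nodes g n) \<and> i < num_nodes g n \<and>
        norm (t i) < norm u \<and> norm u < 1 \<and> norm (t i) < norm v \<and> norm v < 1 \<and> u * v = t i}"

definition plumb_class ::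
    "nat \<Rightarrow> nat \<Rightarrow> (nat \<Rightarrow> complex \<Rightarrow> cpoint) \<Rightarrow> (nat \<Rightarrow> complex \<Rightarrow> cpoint) \<Rightarrow> tpoint \<Rightarrow> tpoint set" where
  "plumb_class g n z w q = (plumb_rel g n z w \<union> (plumb_rel g n z w)\<inverse>)\<^sup>* `` {q}"

text \<open>The charts of the quotient are the local inverses of the quotient map, that is, they come
  from open sets \<open>Q\<close> of the pieces on which the quotient map is injective.\<close>

definition plumb_charts ::
    "nat \<Rightarrow> nat \<Rightarrow> (nat \<Rightarrow> complex \<Rightarrow> cpoint) \<Rightarrow> (nat \<Rightarrow> complex \<Rightarrow> cpoint) \<Rightarrow>
     (tpoint set set \<times> (tpoint set \<Rightarrow> complex)) set" where
  "plumb_charts g n z w =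
     {(plumb_class g n z w ` Q, \<lambda>c. \<zeta> (snd (snd (the_elem (c \<inter> Q))))) | Q k V \<zeta>.
        k < num_comps g n \<and> (V, \<zeta>) \<in> sphere_charts \<and>
        Q \<subseteq> {(t, p) \<in> plumb_pieces g n z w. fst p = k \<and> snd p \<in> V} \<and>
        rel_open (num_nodes g n) ((\<lambda>(t, p). (\<zeta> (snd p), t)) ` Q) \<and>
        inj_on (plumb_class g n z w) Q}"

definition plumbing_family ::
    "nat \<Rightarrow> nat \<Rightarrow> nodal_surface \<Rightarrow> (nat \<Rightarrow> complex \<Rightarrow> cpoint) \<Rightarrow> (nat \<Rightarrow> complex \<Rightarrow> cpoint) \<Rightarrow>
     tpoint set fam" where
  "plumbing_family g n X0 z w =
     \<lparr>bdim = num_nodes g n,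
      base = punctured_polydisc (num_nodes g n),
      points = plumb_class g n z w ` plumb_pieces g n z w,
      proj = (\<lambda>c. the_elem (fst ` c)),
      charts = plumb_charts g n z w,
      mark = (\<lambda>j t. plumb_class g n z w (t, leg X0 j))\<rparr>"

end

theory Submission
  imports Defs
begin

text \<open>Take \<open>g = 0\<close>, \<open>n = 4\<close>: two spheres with one node. On the first sphere let the node be \<open>0\<close>, the
  marked points \<open>\<infinity>\<close> and \<open>b = -8/7\<close>, and the coordinate \<open>z\<close> the Koebe function \<open>k(u) = u / (1 - u)\<^sup>2\<close>; on
  the second let the node be \<open>\<infinity>\<close>, the marked points \<open>-1\<close> and \<open>1\<close>, and \<open>w = 1/y\<close>. The relation \<open>z w = t\<close>
  glues the point \<open>y\<close> of the second sphere to \<open>k(t y)\<close>, so \<open>X\<^sub>t\<close> is the sphere marked at \<open>\<infinity>\<close>, \<open>b\<close>, \<open>k(-t)\<close>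
  and \<open>k(t)\<close>. Its modulus \<open>(k(t) - b) / (k(-t) - b)\<close> has derivative \<open>0\<close> at \<open>t = i/2\<close>. If \<open>\<alpha>\<close> were etale there,
  the sphere marked at \<open>\<infinity>\<close>, \<open>b\<close>, \<open>k(-i/2)\<close> and a fourth point moving at nonzero speed from \<open>k(i/2)\<close>
  would be classified by a holomorphic map to the base, and the chain rule gives a contradiction.\<close>

section \<open>Complex differentiability in two variables\<close>

text \<open>Distortion in \<open>z\<close> is what makes the example work: were \<open>z\<close> an
  affine coordinate, the modulus (t - b) / (-t - b) would have derivative -2b / (t + b)^2, which
  never vanishes. The Koebe function omits only the slit from -1/4 to minus infinity, where b can
  sit, and its derivative turns far: arg k'(i/2) = 4 arctan(1/2) exceeds a right angle. Since k has
  real coefficients, k(-i/2) is conjugate to k(i/2), so for real b the modulus is critical at i/2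
  iff k'(i/2) / (k(i/2) - b) is purely imaginary. Inserting k(i/2) = (-8 + 6i)/25 and k'(i/2) = (-28
  + 96i)/125 gives b = -8/7.

  The labour comes from \<open>etale_at\<close>: refuting it takes a second genuine
  \<open>family\<close>, complete with atlas, properness and genus. The test family therefore keeps
  the total space and charts of the plumbing family and changes only \<open>mark\<close>, so that
  one verification serves both.\<close>

definition hol2 :: "(complex \<times> complex \<Rightarrow> complex) \<Rightarrow> complex \<times> complex \<Rightarrow> bool" where
  "hol2 F p \<longleftrightarrow> (\<exists>c d. (F has_derivative (\<lambda>x. c * fst x + d * snd x)) (at p))"

lemma hol2_fst: "hol2 fst p"
  unfolding hol2_def
  by (rule exI[of _ 1], rule exI[of _ 0]) (auto intro!: derivative_eq_intros)

lemma hol2_snd: "hol2 snd p"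
  unfolding hol2_def
  by (rule exI[of _ 0], rule exI[of _ 1]) (auto intro!: derivative_eq_intros)

lemma hol2_isCont: "hol2 F p \<Longrightarrow> isCont F p"
  unfolding hol2_def using has_derivative_continuous by blast

lemma hol2_tendsto: "hol2 F p \<Longrightarrow> (F \<longlongrightarrow> F p) (nhds p)"
  using hol2_isCont tendsto_at_iff_tendsto_nhds[of F p] by (auto simp: isCont_def)

lemma hol2_compose:
  assumes "hol2 F p" "f field_differentiable at (F p)"
  shows "hol2 (\<lambda>x. f (F x)) p"
proof -
  obtain c d where F: "(F has_derivative (\<lambda>x. c * fst x + d * snd x)) (at p)"
    using assms(1) unfolding hol2_def by blast
  obtain e where "(f has_field_derivative e) (at (F p))"
    using assms(2) unfolding field_differentiable_def by blast
  then have "(f has_derivative (\<lambda>x. e * x)) (at (F p))"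
    by (simp add: has_field_derivative_def)
  from has_derivative_compose[OF F this] show ?thesis
    unfolding hol2_def
    by (intro exI[of _ "e * c"] exI[of _ "e * d"]) (simp add: algebra_simps)
qed

lemma hol2_mult:
  assumes "hol2 F p" "hol2 G p"
  shows "hol2 (\<lambda>x. F x * G x) p"
proof -
  obtain c d where F: "(F has_derivative (\<lambda>x. c * fst x + d * snd x)) (at p)"
    using assms(1) unfolding hol2_def by blast
  obtain c' d' where G: "(G has_derivative (\<lambda>x. c' * fst x + d' * snd x)) (at p)"
    using assms(2) unfolding hol2_def by blast
  from has_derivative_mult[OF F G] show ?thesis
    unfolding hol2_def
    by (intro exI[of _ "F p * c' + c * G p"] exI[of _ "F p * d' + d * G p"])
       (simp add: algebra_simps)
qed

text \<open>\<open>hol2\<close> demands a complex-linear total derivative instead of separate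
  holomorphy, and this is the gain: restriction to any complex curve stays differentiable.
  Coordinate lines yield \<open>holo_prod\<close>; curves traced by marks yield
  \<open>holo\<close>.\<close>

lemma hol2_along:
  assumes F: "hol2 F (f x, g x)" and f: "f field_differentiable at x" and g: "g field_differentiable at x"
  shows "(\<lambda>u. F (f u, g u)) field_differentiable at x"
proof -
  obtain c d where F: "(F has_derivative (\<lambda>x. c * fst x + d * snd x)) (at (f x, g x))"
    using F unfolding hol2_def by blast
  obtain f' where f: "(f has_derivative (\<lambda>x. f' * x)) (at x)"
    using f by (auto simp: field_differentiable_def has_field_derivative_def)
  obtain g' where g: "(g has_derivative (\<lambda>x. g' * x)) (at x)"
    using g by (auto simp: field_differentiable_def has_field_derivative_def)
  have "((\<lambda>u. F (f u, g u)) has_derivative (\<lambda>u. c * (f' * u) + d * (g' * u))) (at x)"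
    using has_derivative_compose[OF has_derivative_Pair[OF f g] F] by simp
  then have "((\<lambda>u. F (f u, g u)) has_derivative (\<lambda>u. (c * f' + d * g') * u)) (at x)"
    by (simp add: algebra_simps)
  then show ?thesis
    unfolding field_differentiable_def has_field_derivative_def by blast
qed

lemma hol2_cong:
  assumes "hol2 F p" "\<forall>\<^sub>F x in nhds p. F x = G x"
  shows "hol2 G p"
proof -
  have "F p = G p" using assms(2) by (rule eventually_nhds_x_imp_x)
  moreover have "\<forall>\<^sub>F x in at p. F x = G x"
    using assms(2) by (auto simp: eventually_at_filter elim: eventually_mono)
  ultimately show ?thesis
    using assms(1) unfolding hol2_def
    using has_derivative_transform_eventually[of F _ p UNIV G] by blast
qed

lemma eventually_nhds_openI:
  assumes "\<And>x. x \<in> S \<Longrightarrow> \<forall>\<^sub>F y in nhds x. y \<in> S"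
  shows "open S"
proof (rule iffD2[OF open_subopen], intro ballI)
  fix x assume "x \<in> S"
  from assms[OF this] show "\<exists>T. open T \<and> x \<in> T \<and> T \<subseteq> S" unfolding eventually_nhds by blast
qed

lemma field_differentiable_cong_ev:
  assumes "f field_differentiable at x" "\<forall>\<^sub>F y in nhds x. f y = g y"
  shows "g field_differentiable at x"
proof -
  obtain d where "(f has_field_derivative d) (at x)"
    using assms(1) unfolding field_differentiable_def ..
  then have "(g has_field_derivative d) (at x)"
    by (rule DERIV_cong_ev[OF refl assms(2) refl, THEN iffD1])
  then show ?thesis unfolding field_differentiable_def ..
qed

lemma field_differentiable_tendsto:
  assumes "f field_differentiable at x"
  shows "(f \<longlongrightarrow> f x) (nhds x)"
proof -
  have "isCont f x" using assms field_differentiable_imp_continuous_at by blast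
  then show ?thesis by (simp add: isCont_def tendsto_at_iff_tendsto_nhds[of f x])
qed

lemma inverse_field_differentiable: "(x::complex) \<noteq> 0 \<Longrightarrow> inverse field_differentiable at x"
  using field_differentiable_inverse[OF field_differentiable_ident, of x] by simp

section \<open>Univalent functions\<close>

text \<open>This describes the automorphisms of the sphere that fix infinity. The difference
  quotient \<open>p\<close> at 0 is entire and, by injectivity, never zero. The open mapping theorem
  bounds its reciprocal \<open>q\<close> linearly, so Liouville makes \<open>q\<close> affine, and
  an affine function without zeros is constant.\<close>

lemma injective_entire_affine:
  fixes h :: "complex \<Rightarrow> complex"
  assumes hol: "h holomorphic_on UNIV" and inj: "inj h"
  obtains c where "c \<noteq> 0" "\<And>x. h x = h 0 + c * x"
proof -
  define p where "p = (\<lambda>x. if x = 0 then deriv h 0 else (h x - h 0) / (x - 0))"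
  have ph: "p holomorphic_on UNIV"
    unfolding p_def by (rule pole_lemma_open[OF hol open_UNIV])
  have d0: "deriv h 0 \<noteq> 0"
    using holomorphic_injective_imp_regular[OF hol open_UNIV inj] by simp
  have p0: "p x \<noteq> 0" for x
    using d0 injD[OF inj] by (auto simp: p_def)
  have "open (h ` ball 0 1)"
    using open_mapping_thm3[of h "ball 0 1"] hol inj holomorphic_on_subset inj_on_subset by blast
  moreover have "h 0 \<in> h ` ball 0 1" by simp
  ultimately obtain e where e: "e > 0" "ball (h 0) e \<subseteq> h ` ball 0 1"
    using open_contains_ball by blast
  \<comment> \<open>All values within \<open>e\<close> of \<open>h 0\<close> are already taken in
    the unit ball, so injectivity forbids them outside it.\<close>
  have far: "norm (h x - h 0) \<ge> e" if "norm x \<ge> 1" for x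
  proof (rule ccontr)
    assume "\<not> ?thesis"
    then have "h x \<in> ball (h 0) e" by (simp add: dist_norm norm_minus_commute)
    then obtain y where "norm y < 1" "h x = h y" using e(2) by fastforce
    then show False using injD[OF inj] that by fastforce
  qed
  define q where "q = (\<lambda>x. inverse (p x))"
  have qh: "q holomorphic_on UNIV"
    unfolding q_def using ph p0 by (intro holomorphic_intros) auto
  have bound: "norm (q x) \<le> inverse e * norm x ^ 1" if "1 \<le> norm x" for x
  proof -
    have "x \<noteq> 0" using that by auto
    then have "norm (q x) = norm x / norm (h x - h 0)"
      by (simp add: q_def p_def norm_divide norm_inverse)
    also have "\<dots> \<le> norm x / e"
      using far[OF that] e(1) by (intro divide_left_mono) (auto intro!: mult_pos_pos)
    finally show ?thesis by (simp add: field_simps)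
  qed
  define \<alpha> \<beta> where "\<alpha> = q 0" and "\<beta> = deriv q 0"
  have "{..1::nat} = {0, 1}" by auto
  have lin: "q x = \<alpha> + \<beta> * x" for x
    using Liouville_polynomial[OF qh bound, where \<xi> = x] unfolding \<open>{..1::nat} = {0, 1}\<close> \<alpha>_def \<beta>_def by simp
  have "\<beta> = 0"
  proof (rule ccontr)
    assume "\<beta> \<noteq> 0"
    then have "q (- \<alpha> / \<beta>) = 0" by (simp add: lin)
    then show False using p0 by (simp add: q_def)
  qed
  then have px: "p x = inverse \<alpha>" for x
    using lin[of x] by (simp add: q_def) (metis inverse_inverse_eq)
  show thesis
  proof
    show "inverse \<alpha> \<noteq> 0" using px p0 by metis
    show "h x = h 0 + inverse \<alpha> * x" for x
      using px[of x] by (auto simp: p_def field_simps split: if_splits)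
  qed
qed

section \<open>The Koebe function\<close>

definition koebe :: "complex \<Rightarrow> complex" where
  "koebe u = u / (1 - u)\<^sup>2"

lemma norm_less_1_neq_1: "norm (u::complex) < 1 \<Longrightarrow> 1 - u \<noteq> 0"
  by auto

lemma koebe_0 [simp]: "koebe 0 = 0"
  by (simp add: koebe_def)

lemma inj_on_koebe: "inj_on koebe (ball 0 1)"
proof (rule inj_onI)
  fix u v assume uv: "u \<in> ball 0 1" "v \<in> ball 0 1" and eq: "koebe u = koebe v"
  then have *: "norm u < 1" "norm v < 1" by simp_all
  then have "u * (1 - v)\<^sup>2 = v * (1 - u)\<^sup>2"
    using eq norm_less_1_neq_1 by (simp add: koebe_def frac_eq_eq)
  \<comment> \<open>The factorisation settles univalence: the second factor cannot vanish because |u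
    v| < 1.\<close>
  moreover have "(u - v) * (1 - u * v) = u * (1 - v)\<^sup>2 - v * (1 - u)\<^sup>2"
    by (simp add: power2_eq_square algebra_simps)
  ultimately have "(u - v) * (1 - u * v) = 0" by simp
  moreover have "norm (u * v) < 1"
    using * norm_mult_less[of u 1 v 1] by simp
  then have "1 - u * v \<noteq> 0" by (rule norm_less_1_neq_1)
  ultimately show "u = v" by simp
qed

lemma koebe_eq_iff: "norm u < 1 \<Longrightarrow> norm v < 1 \<Longrightarrow> koebe u = koebe v \<longleftrightarrow> u = v"
  using inj_on_koebe by (auto simp: inj_on_def)

lemma koebe_DERIV:
  assumes "norm u < 1"
  shows "(koebe has_field_derivative (1 + u) / (1 - u) ^ 3) (at u)"
proof -
  have nz: "1 - u \<noteq> 0" using assms by (rule norm_less_1_neq_1)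
  have "(koebe has_field_derivative (1 * (1 - u)\<^sup>2 - u * (2 * (1 - u) * - 1)) / ((1 - u)\<^sup>2 * (1 - u)\<^sup>2)) (at u)"
    unfolding koebe_def[abs_def] using nz
    by (intro DERIV_divide) (auto intro!: derivative_eq_intros)
  moreover have "1 * (1 - u)\<^sup>2 - u * (2 * (1 - u) * - 1) = (1 + u) * (1 - u)"
    by (simp add: power2_eq_square algebra_simps)
  moreover have "(1 + u) * (1 - u) / ((1 - u)\<^sup>2 * (1 - u)\<^sup>2) = (1 + u) / (1 - u) ^ 3"
    using nz by (simp add: power2_eq_square power3_eq_cube)
  ultimately show ?thesis by simp
qed

lemma koebe_field_differentiable: "norm u < 1 \<Longrightarrow> koebe field_differentiable at u"
  using koebe_DERIV field_differentiable_def by blast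

lemma koebe_holomorphic: "koebe holomorphic_on ball 0 1"
  by (auto simp: holomorphic_on_open field_differentiable_def[symmetric] intro: koebe_field_differentiable)

lemma open_koebe_image: "open S \<Longrightarrow> S \<subseteq> ball 0 1 \<Longrightarrow> open (koebe ` S)"
  using open_mapping_thm3 koebe_holomorphic inj_on_koebe holomorphic_on_subset inj_on_subset by metis

text \<open>The equation \<open>koebe u = - (8/7)\<close> amounts to u^2 - 9/8 u + 1 = 0. The
  negative discriminant makes the two roots conjugate, and their product is 1, so both lie on the
  unit circle.\<close>

lemma koebe_neq_mark:
  assumes "norm u < 1"
  shows "koebe u \<noteq> - (8/7)"
proof
  assume "koebe u = - (8/7)"
  then have "u = - (8/7) * (1 - u)\<^sup>2"
    using norm_less_1_neq_1[OF assms] by (simp add: koebe_def divide_eq_eq)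
  then have "7 * u = - 8 * (1 - u)\<^sup>2" by (metis mult.assoc mult_minus_left nonzero_mult_div_cancel_left times_divide_eq_left times_divide_eq_right zero_neq_numeral)
  moreover have "8 * (u\<^sup>2 - 9/8 * u + 1) = 7 * u + 8 * (1 - u)\<^sup>2"
    by (simp add: power2_eq_square algebra_simps)
  ultimately have "8 * (u\<^sup>2 - 9/8 * u + 1) = 0" by simp
  then have eq: "u\<^sup>2 - 9/8 * u + 1 = 0"
    using mult_eq_0_iff zero_neq_numeral by metis
  obtain x y where u: "u = Complex x y" by (cases u)
  have re: "x\<^sup>2 - y\<^sup>2 - 9/8 * x + 1 = 0" and im: "y * (2 * x - 9/8) = 0"
    using eq by (simp_all add: u complex_eq_iff power2_eq_square algebra_simps)
  have n: "x\<^sup>2 + y\<^sup>2 < 1" using assms by (simp add: u cmod_def)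
  show False
  proof (cases "y = 0")
    case True
    then have "(x - 9/16)\<^sup>2 = (9/16)\<^sup>2 - 1" using re by (simp add: power2_eq_square algebra_simps)
    moreover have "0 \<le> (x - 9/16)\<^sup>2" by simp
    ultimately show False by (simp add: power2_eq_square)
  next
    case False
    then have x: "x = 9/16" using im by simp
    show False using re n unfolding x by (simp add: power2_eq_square)
  qed
qed

definition koebe_inv :: "complex \<Rightarrow> complex" where
  "koebe_inv = inv_into (ball 0 1) koebe"

lemma koebe_inv_koebe: "norm u < 1 \<Longrightarrow> koebe_inv (koebe u) = u"
  by (simp add: koebe_inv_def inj_on_koebe inv_into_f_f)

lemma koebe_inv_field_differentiable:
  assumes "norm u < 1"
  shows "koebe_inv field_differentiable at (koebe u)"
proof -
  obtain g where g: "g holomorphic_on koebe ` ball 0 1" "\<And>z. z \<in> ball 0 1 \<Longrightarrow> g (koebe z) = z"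
    using holomorphic_has_inverse[OF koebe_holomorphic open_ball inj_on_koebe] by metis
  have "koebe_inv holomorphic_on koebe ` ball 0 1"
    by (rule holomorphic_transform[OF g(1)]) (auto simp: g(2) koebe_inv_koebe)
  then show ?thesis
    using assms open_koebe_image[OF open_ball order_refl]
    by (auto simp: holomorphic_on_open field_differentiable_def)
qed

section \<open>Transitions between the fibre coordinates\<close>

text \<open>Because \<open>inverse 0 = 0\<close>, this is an involution on all complex numbers, so
  most computations need no case distinction at 0.\<close>

definition inv_if :: "bool \<Rightarrow> complex \<Rightarrow> complex" where
  "inv_if r a = (if r then inverse a else a)"

text \<open>\<open>sphere_param r\<close> inverts the chart at infinity if \<open>r\<close> holds, and the affine chart otherwise.
  \<open>param_val k r (a, t)\<close> is the point with coordinate \<open>a\<close> on component \<open>k\<close>, seen in the first sphere after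
  gluing with parameter \<open>t\<close>.\<close>

definition sphere_param :: "bool \<Rightarrow> complex \<Rightarrow> sphere" where
  "sphere_param r a = (if r \<and> a = 0 then None else Some (inv_if r a))"

text \<open>For component 0 no disc is removed: the part cut out by plumbing is filled in by the
  second sphere via \<open>koebe\<close>, so the first sphere serves as a coordinate on the whole
  fibre. On the other component the bound says that the point lies outside the disc removed around
  infinity.\<close>

definition param_dom :: "nat \<Rightarrow> bool \<Rightarrow> (complex \<times> complex) set" where
  "param_dom k r = {(a, t). 0 < norm t \<and> norm t < 1 \<and>
     (k = 0 \<or> (r \<longrightarrow> a \<noteq> 0) \<and> norm (t * inv_if r a) < 1)}"

definition param_val :: "nat \<Rightarrow> bool \<Rightarrow> complex \<times> complex \<Rightarrow> sphere" where
  "param_val k r = (\<lambda>(a, t). if k = 0 then sphere_param r a else Some (koebe (t * inv_if r a)))"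

lemma inv_if_inv_if [simp]: "inv_if r (inv_if r a) = a"
  by (simp add: inv_if_def)

lemma inv_if_eq_0_iff [simp]: "inv_if r a = 0 \<longleftrightarrow> a = 0"
  by (simp add: inv_if_def)

lemma inv_if_field_differentiable: "(r \<Longrightarrow> a \<noteq> 0) \<Longrightarrow> inv_if r field_differentiable at a"
  by (cases r) (auto simp: inv_if_def[abs_def] intro!: derivative_intros field_differentiable_inverse)

lemma open_param_dom: "open (param_dom k r)"
proof (cases "k = 0")
  case True
  have "open {p::complex \<times> complex. 0 < norm (snd p) \<and> norm (snd p) < 1}"
    by (intro open_Collect_conj open_Collect_less continuous_intros)
  moreover have "param_dom k r = {p. 0 < norm (snd p) \<and> norm (snd p) < 1}"
    using True by (auto simp: param_dom_def)
  ultimately show ?thesis by simp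
next
  case k: False
  show ?thesis
  proof (cases r)
    case False
    have "open {p::complex \<times> complex. 0 < norm (snd p) \<and> norm (snd p) < 1 \<and> norm (snd p * fst p) < 1}"
      by (intro open_Collect_conj open_Collect_less continuous_intros)
    moreover have "param_dom k r = {p. 0 < norm (snd p) \<and> norm (snd p) < 1 \<and> norm (snd p * fst p) < 1}"
      using k False by (auto simp: param_dom_def inv_if_def)
    ultimately show ?thesis by simp
  next
    case True
    \<comment> \<open>At infinity |t / a| < 1 means |t| < |a|, which also excludes a = 0, so strict
      inequalities between continuous functions cut out the domain.\<close>
    have "open {p::complex \<times> complex. 0 < norm (snd p) \<and> norm (snd p) < 1 \<and> norm (snd p) < norm (fst p)}"
      by (intro open_Collect_conj open_Collect_less continuous_intros)
    moreover have "param_dom k r = {p. 0 < norm (snd p) \<and> norm (snd p) < 1 \<and> norm (snd p) < norm (fst p)}"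
      using k True by (auto simp: param_dom_def inv_if_def norm_divide divide_less_eq_1 field_simps)
    ultimately show ?thesis by simp
  qed
qed

lemma sphere_param_eq_Some: "sphere_param r a = Some x \<longleftrightarrow> (r \<longrightarrow> a \<noteq> 0) \<and> x = inv_if r a"
  by (auto simp: sphere_param_def)

lemma sphere_param_inv_if: "(r \<Longrightarrow> a \<noteq> 0) \<Longrightarrow> sphere_param r a = Some (inv_if r a)"
  by (auto simp: sphere_param_def)

text \<open>Continuity of \<open>T\<close> and openness of both domains supply the domain conditions
  nearby, so a candidate transition only has to be checked against \<open>param_val\<close> where
  everything is defined.\<close>

lemma param_val_transition_aux:
  assumes T: "hol2 T (a, t)" "T (a, t) = a'"
    and dom: "(a, t) \<in> param_dom k r" "(a', t) \<in> param_dom k' r'"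
    and ev: "\<forall>\<^sub>F p in nhds (a, t). p \<in> param_dom k r \<longrightarrow> (T p, snd p) \<in> param_dom k' r' \<longrightarrow>
       param_val k' r' (T p, snd p) = param_val k r p"
  shows "\<exists>T. hol2 T (a, t) \<and> T (a, t) = a' \<and>
     (\<forall>\<^sub>F p in nhds (a, t). (T p, snd p) \<in> param_dom k' r' \<and> param_val k' r' (T p, snd p) = param_val k r p)"
proof -
  have e1: "\<forall>\<^sub>F p in nhds (a, t). p \<in> param_dom k r"
    using dom(1) open_param_dom by (simp add: eventually_nhds_in_open)
  have "isCont (\<lambda>p. (T p, snd p)) (a, t)"
    using hol2_isCont[OF T(1)] hol2_isCont[OF hol2_snd] by (intro isCont_Pair)
  then have "filterlim (\<lambda>p. (T p, snd p)) (nhds (T (a, t), snd (a, t))) (nhds (a, t))"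
    unfolding isCont_def using tendsto_at_iff_tendsto_nhds[of "\<lambda>p. (T p, snd p)" "(a, t)"] by simp
  then have "filterlim (\<lambda>p. (T p, snd p)) (nhds (a', t)) (nhds (a, t))"
    by (simp add: T(2))
  then have e2: "\<forall>\<^sub>F p in nhds (a, t). (T p, snd p) \<in> param_dom k' r'"
    using eventually_nhds_in_open[OF open_param_dom dom(2)] unfolding filterlim_iff by blast
  show ?thesis
  proof (intro exI[of _ T] conjI)
    show "\<forall>\<^sub>F p in nhds (a, t). (T p, snd p) \<in> param_dom k' r' \<and> param_val k' r' (T p, snd p) = param_val k r p"
      using e1 e2 ev by eventually_elim blast
  qed (use T in auto)
qed

lemma eventually_nhds_fst_neq: "a \<noteq> (0::complex) \<Longrightarrow> \<forall>\<^sub>F p in nhds (a, t::complex). fst p \<noteq> 0"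
  by (rule tendsto_imp_eventually_ne[OF tendsto_fst[OF filterlim_ident]]) simp

text \<open>Up to inversions of the coordinates, the transitions are the identity, the gluing y to
  \<open>koebe\<close> (t y), and its inverse. They are holomorphic in the coordinate and in the
  gluing parameter jointly, which is what makes the plumbed surfaces a holomorphic family.\<close>

lemma param_val_transition:
  assumes dom: "(a, t) \<in> param_dom k r" "(a', t) \<in> param_dom k' r'"
    and eq: "param_val k r (a, t) = param_val k' r' (a', t)"
  shows "\<exists>T. hol2 T (a, t) \<and> T (a, t) = a' \<and>
     (\<forall>\<^sub>F p in nhds (a, t). (T p, snd p) \<in> param_dom k' r' \<and> param_val k' r' (T p, snd p) = param_val k r p)"
proof -
  have t: "t \<noteq> 0" using dom by (auto simp: param_dom_def)
  consider (same) "k = 0" "k' = 0" "r = r'" | (inf) "k = 0" "k' = 0" "r \<noteq> r'"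
    | (up) "k = 0" "k' \<noteq> 0" | (down) "k \<noteq> 0" "k' = 0" | (top) "k \<noteq> 0" "k' \<noteq> 0"
    by blast
  then show ?thesis
  proof cases
    case same
    then have "a' = a" using eq by (auto simp: param_val_def sphere_param_def inv_if_def split: if_splits)
    then show ?thesis
      using dom same by (intro param_val_transition_aux[of fst]) (auto simp: hol2_fst)
  next
    case inf
    then have a: "a \<noteq> 0" "a' = inverse a"
      using eq by (auto simp: param_val_def sphere_param_def inv_if_def split: if_splits)
    have "\<forall>\<^sub>F p in nhds (a, t). fst p \<noteq> 0"
      using a(1) by (rule eventually_nhds_fst_neq)
    show ?thesis
    proof (rule param_val_transition_aux[of "\<lambda>p. inverse (fst p)"])
      show "hol2 (\<lambda>p. inverse (fst p)) (a, t)"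
        by (rule hol2_compose[OF hol2_fst]) (simp add: a inverse_field_differentiable)
      show "\<forall>\<^sub>F p in nhds (a, t). p \<in> param_dom k r \<longrightarrow> (inverse (fst p), snd p) \<in> param_dom k' r' \<longrightarrow>
        param_val k' r' (inverse (fst p), snd p) = param_val k r p"
        using \<open>\<forall>\<^sub>F p in nhds (a, t). fst p \<noteq> 0\<close>
        by eventually_elim (use inf in \<open>auto simp: param_val_def sphere_param_def inv_if_def case_prod_beta\<close>)
    qed (use a dom in auto)
  next
    \<comment> \<open>Univalence of \<open>koebe\<close> and t \<noteq> 0 force the two points of
      the second sphere to coincide, so only the choice of sphere chart can differ.\<close>
    case top
    have "koebe (t * inv_if r a) = koebe (t * inv_if r' a')"
      using eq top by (simp add: param_val_def)
    then have "t * inv_if r a = t * inv_if r' a'"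
      using dom top by (subst (asm) koebe_eq_iff) (auto simp: param_dom_def)
    then have a': "a' = inv_if r' (inv_if r a)"
      using t by simp
    have r: "r \<Longrightarrow> a \<noteq> 0" "r' \<Longrightarrow> inv_if r a \<noteq> 0"
      using dom top by (auto simp: param_dom_def a')
    show ?thesis
    proof (rule param_val_transition_aux[of "\<lambda>p. inv_if r' (inv_if r (fst p))"])
      show "hol2 (\<lambda>p. inv_if r' (inv_if r (fst p))) (a, t)"
        by (rule hol2_compose[OF hol2_compose[OF hol2_fst], where f = "inv_if r'"])
          (use r in \<open>auto intro: inv_if_field_differentiable\<close>)
      show "\<forall>\<^sub>F p in nhds (a, t). p \<in> param_dom k r \<longrightarrow> (inv_if r' (inv_if r (fst p)), snd p) \<in> param_dom k' r' \<longrightarrow>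
        param_val k' r' (inv_if r' (inv_if r (fst p)), snd p) = param_val k r p"
        using top by (intro always_eventually) (auto simp: param_val_def)
    qed (use a' dom in auto)
  next
    \<comment> \<open>From the first sphere to the second: solve x = \<open>koebe\<close> (t y) for
      y = \<open>koebe_inv\<close> x / t.\<close>
    case up
    have x: "sphere_param r a = Some (koebe (t * inv_if r' a'))" using eq up by (simp add: param_val_def)
    have nr: "norm (t * inv_if r' a') < 1" "r' \<Longrightarrow> a' \<noteq> 0" using dom up by (auto simp: param_dom_def)
    have ra: "r \<Longrightarrow> a \<noteq> 0" and xa: "inv_if r a = koebe (t * inv_if r' a')" using x by (auto simp: sphere_param_eq_Some)
    have kx: "koebe_inv (inv_if r a) = t * inv_if r' a'" using xa koebe_inv_koebe[OF nr(1)] by simp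
    have "t * inv_if r' a' * inverse t = inv_if r' a'" using t by (simp add: mult.commute[of t] mult.assoc)
    then have a': "a' = inv_if r' (koebe_inv (inv_if r a) * inverse t)" by (simp only: kx inv_if_inv_if)
    have h1: "hol2 (\<lambda>p. inv_if r (fst p)) (a, t)"
      by (rule hol2_compose[OF hol2_fst]) (use ra in \<open>auto intro: inv_if_field_differentiable\<close>)
    have h2: "hol2 (\<lambda>p. koebe_inv (inv_if r (fst p))) (a, t)"
      by (rule hol2_compose[OF h1]) (use koebe_inv_field_differentiable[OF nr(1)] xa in auto)
    have h3: "hol2 (\<lambda>p. koebe_inv (inv_if r (fst p)) * inverse (snd p)) (a, t)"
      by (rule hol2_mult[OF h2 hol2_compose[OF hol2_snd]]) (use t in \<open>simp add: inverse_field_differentiable\<close>)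
    have h4: "hol2 (\<lambda>p. inv_if r' (koebe_inv (inv_if r (fst p)) * inverse (snd p))) (a, t)"
      by (rule hol2_compose[OF h3], rule inv_if_field_differentiable) (use nr t in \<open>auto simp: kx\<close>)
    have c1: "((\<lambda>p. inv_if r (fst p)) \<longlongrightarrow> inv_if r a) (nhds (a, t))"
      using hol2_tendsto[OF h1] by simp
    have "inv_if r a \<in> koebe ` ball 0 1" using nr xa by auto
    then have e1: "\<forall>\<^sub>F p in nhds (a, t). inv_if r (fst p) \<in> koebe ` ball 0 1"
      using topological_tendstoD[OF c1 open_koebe_image[OF open_ball order_refl]] by simp
    have e2: "\<forall>\<^sub>F p in nhds (a, t). r \<longrightarrow> fst p \<noteq> 0"
    proof (cases r)
      case True
      then show ?thesis using ra
        by (intro eventually_mono[OF eventually_nhds_fst_neq]) auto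
    qed simp
    show ?thesis
    proof (rule param_val_transition_aux[OF h4])
      show "\<forall>\<^sub>F p in nhds (a, t). p \<in> param_dom k r \<longrightarrow>
        (inv_if r' (koebe_inv (inv_if r (fst p)) * inverse (snd p)), snd p) \<in> param_dom k' r' \<longrightarrow>
        param_val k' r' (inv_if r' (koebe_inv (inv_if r (fst p)) * inverse (snd p)), snd p) = param_val k r p"
        using e1 e2
      proof eventually_elim
        case (elim p)
        then obtain u where u: "norm u < 1" "inv_if r (fst p) = koebe u" by auto
        show ?case
        proof (intro impI)
          assume "p \<in> param_dom k r"
          then have "snd p \<noteq> 0" by (auto simp: param_dom_def)
          then have "koebe (snd p * (u * inverse (snd p))) = koebe u" by (simp add: mult.left_commute[of "snd p"])
          then show "param_val k' r' (inv_if r' (koebe_inv (inv_if r (fst p)) * inverse (snd p)), snd p) = param_val k r p"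
            using up u elim koebe_inv_koebe[OF u(1)] by (simp add: param_val_def case_prod_beta sphere_param_inv_if)
        qed
      qed
    qed (use a' dom in auto)
  next
    case down
    have "sphere_param r' a' = Some (koebe (t * inv_if r a))" using eq down by (simp add: param_val_def)
    then have ra': "r' \<Longrightarrow> a' \<noteq> 0" and xa: "inv_if r' a' = koebe (t * inv_if r a)" by (auto simp: sphere_param_eq_Some)
    have nr: "norm (t * inv_if r a) < 1" "r \<Longrightarrow> a \<noteq> 0" using dom down by (auto simp: param_dom_def)
    have a': "a' = inv_if r' (koebe (t * inv_if r a))" by (simp flip: xa)
    have h1: "hol2 (\<lambda>p. inv_if r (fst p)) (a, t)"
      by (rule hol2_compose[OF hol2_fst]) (use nr in \<open>auto intro: inv_if_field_differentiable\<close>)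
    have h2: "hol2 (\<lambda>p. snd p * inv_if r (fst p)) (a, t)"
      by (rule hol2_mult[OF hol2_snd h1])
    have h3: "hol2 (\<lambda>p. koebe (snd p * inv_if r (fst p))) (a, t)"
      by (rule hol2_compose[OF h2], rule koebe_field_differentiable) (use nr in auto)
    have h4: "hol2 (\<lambda>p. inv_if r' (koebe (snd p * inv_if r (fst p)))) (a, t)"
      by (rule hol2_compose[OF h3], rule inv_if_field_differentiable) (use ra' in \<open>auto simp flip: xa\<close>)
    have c3: "((\<lambda>p. koebe (snd p * inv_if r (fst p))) \<longlongrightarrow> koebe (t * inv_if r a)) (nhds (a, t))"
      using hol2_tendsto[OF h3] by simp
    have e: "\<forall>\<^sub>F p in nhds (a, t). r' \<longrightarrow> koebe (snd p * inv_if r (fst p)) \<noteq> 0"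
    proof (cases r')
      case True
      then show ?thesis using ra' xa
        by (intro eventually_mono[OF tendsto_imp_eventually_ne[OF c3]]) auto
    qed simp
    show ?thesis
    proof (rule param_val_transition_aux[OF h4])
      show "\<forall>\<^sub>F p in nhds (a, t). p \<in> param_dom k r \<longrightarrow>
        (inv_if r' (koebe (snd p * inv_if r (fst p))), snd p) \<in> param_dom k' r' \<longrightarrow>
        param_val k' r' (inv_if r' (koebe (snd p * inv_if r (fst p))), snd p) = param_val k r p"
        using e by eventually_elim (use down in \<open>simp add: param_val_def case_prod_beta sphere_param_inv_if\<close>)
    qed (use a' dom in auto)
  qed
qed

lemma param_val_inj:
  assumes "(a, t) \<in> param_dom k r" "(a', t) \<in> param_dom k r" "param_val k r (a, t) = param_val k r (a', t)"
  shows "a = a'"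
proof (cases "k = 0")
  case True
  then show ?thesis using assms(3) by (auto simp: param_val_def sphere_param_def inv_if_def split: if_splits)
next
  case False
  then have "t * inv_if r a = t * inv_if r a'"
    using assms by (subst koebe_eq_iff[symmetric]) (auto simp: param_dom_def param_val_def)
  moreover have "t \<noteq> 0" using assms by (auto simp: param_dom_def)
  ultimately show ?thesis by (metis inv_if_inv_if mult_cancel_left)
qed

section \<open>Families over a one-dimensional base\<close>

definition vec1 :: "complex \<Rightarrow> cvec" where
  "vec1 u = (\<lambda>i. if i = 0 then u else 0)"

text \<open>The base is one-dimensional but lives in a sequence space. Pulling back along
  \<open>lift\<close> moves every openness and holomorphy condition to
  \<open>complex \<times> complex\<close>.\<close>

definition lift :: "complex \<times> complex \<Rightarrow> complex \<times> cvec" where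
  "lift = (\<lambda>(a, t). (a, vec1 t))"

lemma vec1_0 [simp]: "vec1 u 0 = u"
  by (simp add: vec1_def)

lemma vec1_eq_iff [simp]: "vec1 u = vec1 v \<longleftrightarrow> u = v"
  by (metis vec1_0)

lemma vec1_upd [simp]: "(vec1 u)(0 := v) = vec1 v"
  by (auto simp: vec1_def)

lemma Cn_1: "Cn (Suc 0) = range vec1"
proof
  show "Cn (Suc 0) \<subseteq> range vec1"
  proof
    fix s assume "s \<in> Cn (Suc 0)"
    then have "s = vec1 (s 0)" by (auto simp: Cn_def vec1_def fun_eq_iff)
    then show "s \<in> range vec1" by blast
  qed
qed (auto simp: Cn_def vec1_def)

lemma vec1_in_Cn_1 [simp]: "vec1 u \<in> Cn (Suc 0)"
  unfolding Cn_1 by blast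

lemma continuous_on_vec1: "continuous_on S vec1"
proof (rule continuous_on_coordinatewise_then_product)
  show "continuous_on S (\<lambda>x. vec1 x i)" for i by (cases "i = 0") (auto simp: vec1_def)
qed

lemma continuous_on_lift: "continuous_on S lift"
  unfolding lift_def case_prod_beta
  by (intro continuous_on_Pair continuous_intros continuous_on_compose2[OF continuous_on_vec1]) auto

lemma continuous_on_coord_0: "continuous_on S (\<lambda>s::cvec. s 0)"
  by (rule continuous_on_subset[OF continuous_on_product_coordinates]) simp

lemma punctured_polydisc_1: "punctured_polydisc (Suc 0) = vec1 ` {t. 0 < norm t \<and> norm t < 1}"
  unfolding punctured_polydisc_def Cn_1 by auto

lemma lift_inject [simp]: "lift p = lift q \<longleftrightarrow> p = q"
  by (cases p; cases q) (simp add: lift_def)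

lemma openin_Cn_1_iff:
  "openin (top_of_set (Cn (Suc 0))) S \<longleftrightarrow> (\<exists>M. open M \<and> S = vec1 ` M)"
proof
  assume "openin (top_of_set (Cn (Suc 0))) S"
  then obtain W where W: "open W" "S = Cn (Suc 0) \<inter> W" by (auto simp: openin_open)
  have "open (vec1 -` W)" using continuous_on_vec1 W(1) open_vimage by blast
  moreover have "S = vec1 ` (vec1 -` W)" using W(2) by (auto simp: Cn_1)
  ultimately show "\<exists>M. open M \<and> S = vec1 ` M" by blast
next
  assume "\<exists>M. open M \<and> S = vec1 ` M"
  then obtain M where M: "open M" "S = vec1 ` M" by blast
  have "open ((\<lambda>s::cvec. s 0) -` M)" using continuous_on_coord_0 M(1) open_vimage by blast
  moreover have "S = Cn (Suc 0) \<inter> (\<lambda>s. s 0) -` M" using M(2) by (auto simp: Cn_1)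
  ultimately show "openin (top_of_set (Cn (Suc 0))) S" by (auto simp: openin_open)
qed

lemma rel_open_1_iff:
  "rel_open (Suc 0) W \<longleftrightarrow> (\<exists>N. open N \<and> W = lift ` N)"
proof
  assume "rel_open (Suc 0) W"
  then obtain O' where O': "open O'" "W = (UNIV \<times> Cn (Suc 0)) \<inter> O'" by (auto simp: rel_open_def openin_open)
  have "open (lift -` O')" using continuous_on_lift O'(1) open_vimage by blast
  moreover have "W = lift ` (lift -` O')" using O'(2) by (fastforce simp: Cn_1 lift_def)
  ultimately show "\<exists>N. open N \<and> W = lift ` N" by blast
next
  assume "\<exists>N. open N \<and> W = lift ` N"
  then obtain N where N: "open N" "W = lift ` N" by blast
  have "continuous_on UNIV (\<lambda>x::complex \<times> cvec. (fst x, snd x 0))"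
    by (intro continuous_on_Pair continuous_intros continuous_on_compose2[OF continuous_on_coord_0]) auto
  then have "open ((\<lambda>x::complex \<times> cvec. (fst x, snd x 0)) -` N)" using N(1) open_vimage by blast
  moreover have "W = (UNIV \<times> Cn (Suc 0)) \<inter> (\<lambda>x. (fst x, snd x 0)) -` N"
    using N(2) by (force simp: Cn_1 lift_def)
  ultimately show "rel_open (Suc 0) W" by (auto simp: rel_open_def openin_open)
qed

lemma rel_open_1_lift: "rel_open (Suc 0) (lift ` N) \<longleftrightarrow> open N"
proof
  assume "rel_open (Suc 0) (lift ` N)"
  then obtain N' where "open N'" "lift ` N = lift ` N'" unfolding rel_open_1_iff by blast
  moreover have "inj lift" by (simp add: inj_def)
  ultimately show "open N" by (simp add: inj_image_eq_iff)
qed (auto simp: rel_open_1_iff)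

lemma holo_prod_1:
  assumes F: "\<And>p. p \<in> N \<Longrightarrow> hol2 (\<lambda>p. F (lift p)) p"
  shows "holo_prod (Suc 0) (lift ` N) F"
  unfolding holo_prod_def
proof (intro conjI)
  define pr where "pr = (\<lambda>x::complex \<times> cvec. (fst x, snd x 0))"
  have prl: "pr (lift p) = p" for p by (cases p) (simp add: pr_def lift_def)
  have c1: "continuous_on (lift ` N) pr"
    unfolding pr_def
    by (intro continuous_on_Pair continuous_intros continuous_on_compose2[OF continuous_on_coord_0]) auto
  have c2: "continuous_on N (\<lambda>p. F (lift p))"
    using hol2_isCont[OF F] by (intro continuous_at_imp_continuous_on) auto
  have "pr ` lift ` N \<subseteq> N" by (auto simp: prl)
  from continuous_on_compose2[OF c2 c1 this]
  have "continuous_on (lift ` N) (\<lambda>x. F (lift (pr x)))" .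
  moreover have "F (lift (pr x)) = F x" if "x \<in> lift ` N" for x
    using that by (auto simp: prl)
  ultimately show "continuous_on (lift ` N) F"
    by (rule continuous_on_eq)
  show "\<forall>(x, s)\<in>lift ` N. (\<lambda>u. F (u, s)) field_differentiable at x \<and>
     (\<forall>i<Suc 0. (\<lambda>u. F (x, s(i := u))) field_differentiable at (s i))"
  proof clarify
    fix x s a t assume N: "(a, t) \<in> N" and "(x, s) = lift (a, t)"
    then have x: "x = a" "s = vec1 t" by (auto simp: lift_def)
    have "(\<lambda>u. F (lift (u, t))) field_differentiable at a"
      using hol2_along[of "\<lambda>p. F (lift p)" "\<lambda>u. u" a "\<lambda>_. t", OF F[OF N] field_differentiable_ident field_differentiable_const] .
    moreover have "(\<lambda>u. F (lift (a, u))) field_differentiable at t"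
      using hol2_along[of "\<lambda>p. F (lift p)" "\<lambda>_. a" t "\<lambda>u. u", OF F[OF N] field_differentiable_const field_differentiable_ident] .
    ultimately show "(\<lambda>u. F (u, s)) field_differentiable at x \<and>
      (\<forall>i<Suc 0. (\<lambda>u. F (x, s(i := u))) field_differentiable at (s i))"
      by (simp add: x lift_def)
  qed
qed

lemma holo_1:
  assumes f: "\<And>t. t \<in> M \<Longrightarrow> (\<lambda>t. f (vec1 t)) field_differentiable at t"
  shows "holo (Suc 0) (vec1 ` M) f"
  unfolding holo_def
proof (intro conjI)
  have "continuous_on M (\<lambda>t. f (vec1 t))"
    using field_differentiable_imp_continuous_at[OF f] by (intro continuous_at_imp_continuous_on) auto
  then have "continuous_on (vec1 ` M) (\<lambda>s. f (vec1 (s 0)))"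
    by (intro continuous_on_compose2[of M "\<lambda>t. f (vec1 t)" _ "\<lambda>s. s 0"]) (auto intro: continuous_on_coord_0)
  then show "continuous_on (vec1 ` M) f"
    by (rule continuous_on_eq) auto
qed (use f in auto)

section \<open>The plumbing family of two spheres\<close>

definition two_spheres :: nodal_surface where
  "two_spheres = \<lparr>node1 = \<lambda>i. (0, Some 0), node2 = \<lambda>i. (1, None),
     leg = \<lambda>j. if j = 0 then (0, None) else if j = 1 then (0, Some (- (8/7)))
               else if j = 2 then (1, Some (- 1)) else (1, Some 1)\<rparr>"

definition z_coord :: "nat \<Rightarrow> complex \<Rightarrow> cpoint" where
  "z_coord i u = (0, Some (koebe u))"

definition w_coord :: "nat \<Rightarrow> complex \<Rightarrow> cpoint" where
  "w_coord i v = (1, sphere_param True v)"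

lemma num_04 [simp]: "num_nodes 0 4 = Suc 0" "num_comps 0 4 = 2"
  by (simp_all add: num_nodes_def num_comps_def)

lemma special_points_two_spheres:
  "special_points 0 4 two_spheres =
     [(0, Some 0), (1, None), (0, None), (0, Some (- (8/7))), (1, Some (- 1)), (1, Some 1)]"
proof -
  have "[0..<4] = [0, 1, 2, 3::nat]" by (simp add: upt_rec)
  then show ?thesis by (simp add: special_points_def two_spheres_def)
qed

lemma maximally_degenerate_two_spheres: "maximally_degenerate 0 4 two_spheres"
proof -
  have *: "{p \<in> set (special_points 0 4 two_spheres). fst p = 0} = {(0, Some 0), (0, None), (0, Some (- (8/7)))}"
    "{p \<in> set (special_points 0 4 two_spheres). fst p = Suc 0} = {(1, None), (1, Some (- 1)), (1, Some 1)}"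
    by (auto simp: special_points_two_spheres)
  have adj: "(0, 1) \<in> adjacent 0 4 two_spheres"
    by (auto simp: adjacent_def two_spheres_def)
  have conn: "(a, b) \<in> (adjacent 0 4 two_spheres \<union> (adjacent 0 4 two_spheres)\<inverse>)\<^sup>*" if "a < 2" "b < 2" for a b
    using that adj by (auto simp: less_2_cases_iff)
  have dist: "distinct (special_points 0 4 two_spheres)"
    and comps: "\<forall>p\<in>set (special_points 0 4 two_spheres). fst p < 2"
    by (simp_all add: special_points_two_spheres)
  have card: "\<forall>k<2. card {p \<in> set (special_points 0 4 two_spheres). fst p = k} = 3"
  proof (intro allI impI)
    fix k :: nat assume "k < 2"
    then consider "k = 0" | "k = Suc 0" by linarith
    then show "card {p \<in> set (special_points 0 4 two_spheres). fst p = k} = 3"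
    proof cases
      case 1
      show ?thesis unfolding 1 *(1) by simp
    next
      case 2
      show ?thesis unfolding 2 *(2) by simp
    qed
  qed
  show ?thesis
    unfolding maximally_degenerate_def num_04
    by (intro conjI dist comps card allI impI conn) simp_all
qed

lemma ball_sphere_charts:
  "(\<forall>(V, \<zeta>)\<in>sphere_charts. P V \<zeta>) \<longleftrightarrow> P (- {None}) the \<and> P (- {Some 0}) (case_option 0 inverse)"
  by (simp add: sphere_charts_def)

lemma disc_embedding_z_coord: "disc_embedding (set (special_points 0 4 two_spheres)) (0, Some 0) (z_coord i)"
proof -
  have ball: "unit_disc = ball 0 1" by (auto simp: unit_disc_def)
  have 0: "koebe u = 0 \<longleftrightarrow> u = 0" if "norm u < 1" for u
    using koebe_eq_iff[OF that, of 0] by simp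
  have sets: "{u \<in> ball 0 1. snd (z_coord i u) \<in> - {None}} = ball 0 1"
    "{u \<in> ball 0 1. snd (z_coord i u) \<in> - {Some 0}} = ball 0 1 - {0}"
    using 0 by (auto simp: z_coord_def)
  have funs: "(\<lambda>u. the (snd (z_coord i u))) = koebe"
    "(\<lambda>u. case_option 0 inverse (snd (z_coord i u))) = (\<lambda>u. inverse (koebe u))"
    by (auto simp: z_coord_def)
  have "koebe holomorphic_on ball 0 1 - {0}"
    using koebe_holomorphic holomorphic_on_subset by blast
  then have h: "(\<lambda>u. inverse (koebe u)) holomorphic_on ball 0 1 - {0}"
    using 0 by (intro holomorphic_on_inverse) auto
  have "z_coord i ` unit_disc \<inter> set (special_points 0 4 two_spheres) \<subseteq> {(0, Some 0)}"
    using koebe_neq_mark by (auto simp: special_points_two_spheres z_coord_def unit_disc_def)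
  moreover have "inj_on (z_coord i) unit_disc"
    using inj_on_koebe by (auto simp: z_coord_def inj_on_def unit_disc_def)
  ultimately show ?thesis
    unfolding disc_embedding_def ball ball_sphere_charts sets funs
    using h koebe_holomorphic by (auto simp: z_coord_def intro: open_delete)
qed

lemma disc_embedding_w_coord: "disc_embedding (set (special_points 0 4 two_spheres)) (1, None) (w_coord i)"
proof -
  have ball: "unit_disc = ball 0 1" by (auto simp: unit_disc_def)
  have sets: "{u \<in> ball 0 1. snd (w_coord i u) \<in> - {None}} = ball 0 1 - {0}"
    "{u \<in> ball 0 1. snd (w_coord i u) \<in> - {Some 0}} = ball 0 1"
    by (auto simp: w_coord_def sphere_param_def inv_if_def)
  have "(\<lambda>u. the (snd (w_coord i u))) holomorphic_on ball 0 1 - {0}"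
    by (rule holomorphic_transform[of inverse]) (auto intro!: holomorphic_intros simp: w_coord_def sphere_param_def inv_if_def)
  moreover have "(\<lambda>u. case_option 0 inverse (snd (w_coord i u))) = (\<lambda>u. u)"
    by (auto simp: w_coord_def sphere_param_def inv_if_def)
  \<comment> \<open>The marks 1 and -1 have \<open>w\<close>-coordinates of modulus 1, so they lie
    on the boundary circle, just outside the open disc.\<close>
  moreover have "w_coord i ` unit_disc \<inter> set (special_points 0 4 two_spheres) \<subseteq> {(1, None)}"
    by (auto simp: special_points_two_spheres w_coord_def unit_disc_def sphere_param_eq_Some inv_if_def)
      (metis inverse_inverse_eq inverse_1 norm_one norm_minus_cancel inverse_minus_eq less_irrefl)+
  moreover have "inj_on (w_coord i) unit_disc"
    by (auto simp: w_coord_def inj_on_def sphere_param_def inv_if_def split: if_splits)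
  ultimately show ?thesis
    unfolding disc_embedding_def ball ball_sphere_charts sets
    by (auto simp: w_coord_def sphere_param_def)
qed

lemma local_coordinates_two_spheres: "local_coordinates 0 4 two_spheres z_coord w_coord"
proof -
  have "node1 two_spheres i = (0, Some 0)" "node2 two_spheres i = (1, None)" for i
    by (simp_all add: two_spheres_def)
  then show ?thesis
    unfolding local_coordinates_def by (simp only: disc_embedding_z_coord disc_embedding_w_coord simp_thms)
qed

lemma disjointness_property_two_spheres: "disjointness_property 0 4 z_coord w_coord"
  unfolding disjointness_property_def num_04 by (auto simp: z_coord_def w_coord_def)

abbreviation base1 :: "cvec set" where
  "base1 \<equiv> punctured_polydisc (Suc 0)"

section \<open>The plumbed fibres as quotients of the two pieces\<close>

definition pieces :: "tpoint set" where
  "pieces = plumb_pieces 0 4 z_coord w_coord"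

text \<open>\<open>psi\<close> identifies each plumbed fibre with the first sphere; its fibres are the gluing classes.\<close>

definition psi :: "tpoint \<Rightarrow> cvec \<times> sphere" where
  "psi = (\<lambda>(t, k, x). (t, if k = 0 then x else map_option (\<lambda>y. koebe (t 0 * y)) x))"

definition glued :: "cvec \<times> sphere \<Rightarrow> tpoint set" where
  "glued p = {q \<in> pieces. psi q = p}"

lemma pieces_0:
  "(t, 0, x) \<in> pieces \<longleftrightarrow> t \<in> base1 \<and> (\<forall>u. norm u \<le> norm (t 0) \<longrightarrow> x \<noteq> Some (koebe u))"
proof -
  have "(0, x) \<notin> z_coord i ` {u. norm u \<le> norm (t 0)} \<longleftrightarrow> (\<forall>u. norm u \<le> norm (t 0) \<longrightarrow> x \<noteq> Some (koebe u))"
    "(0, x) \<notin> w_coord i ` {u. norm u \<le> norm (t 0)}" for i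
    by (auto simp: z_coord_def w_coord_def image_iff)
  then show ?thesis by (simp add: pieces_def plumb_pieces_def)
qed

text \<open>Removing |w| \<le> |t| with w = 1/y leaves |y| < 1/|t|, exactly where
  \<open>koebe\<close> (t y) is evaluated inside the unit disc.\<close>

lemma pieces_1:
  "(t, Suc 0, x) \<in> pieces \<longleftrightarrow> t \<in> base1 \<and> (\<exists>y. x = Some y \<and> norm (t 0 * y) < 1)"
proof -
  have "(\<forall>u. norm u \<le> norm (t 0) \<longrightarrow> x \<noteq> sphere_param True u) \<longleftrightarrow> (\<exists>y. x = Some y \<and> norm (t 0 * y) < 1)"
    if t: "t 0 \<noteq> 0"
  proof (cases x)
    case None
    then show ?thesis by (auto simp: sphere_param_def intro!: exI[of _ 0])
  next
    case (Some y)
    show ?thesis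
    proof (cases "y = 0")
      case True
      then show ?thesis using Some by (auto simp: sphere_param_def inv_if_def)
    next
      case False
      have "(\<forall>u. norm u \<le> norm (t 0) \<longrightarrow> x \<noteq> sphere_param True u) \<longleftrightarrow> \<not> norm (inverse y) \<le> norm (t 0)"
        using Some False by (auto simp: sphere_param_def inv_if_def dest: spec[of _ "inverse y"])
      also have "\<dots> \<longleftrightarrow> norm (t 0 * y) < 1"
        using False by (auto simp: norm_mult norm_divide inverse_eq_divide field_simps not_le)
      finally show ?thesis using Some by simp
    qed
  qed
  moreover have "t 0 \<noteq> 0" if "t \<in> base1" using that by (auto simp: punctured_polydisc_def)
  ultimately show ?thesis
    by (auto simp: pieces_def plumb_pieces_def z_coord_def w_coord_def)
qed

lemma pieces_comp: "(t, k, x) \<in> pieces \<Longrightarrow> k = 0 \<or> k = Suc 0"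
  by (simp add: pieces_def plumb_pieces_def less_2_cases_iff)

lemma base1_nz: "t \<in> base1 \<Longrightarrow> t 0 \<noteq> 0 \<and> norm (t 0) < 1"
  by (simp add: punctured_polydisc_def)

text \<open>The points deleted from the first sphere are the \<open>koebe u\<close> with |u| \<le>
  |t|, and the second sphere supplies each of them at y = u / t.\<close>

lemma psi_image: "psi ` pieces = base1 \<times> UNIV"
proof
  show "psi ` pieces \<subseteq> base1 \<times> UNIV"
    by (auto simp: psi_def pieces_def plumb_pieces_def)
  show "base1 \<times> UNIV \<subseteq> psi ` pieces"
  proof clarify
    fix t x assume t: "t \<in> base1"
    show "(t, x) \<in> psi ` pieces"
    proof (cases "(t, 0, x) \<in> pieces")
      case True
      then show ?thesis by (force simp: psi_def)
    next
      case False
      then obtain u where u: "norm u \<le> norm (t 0)" "x = Some (koebe u)" using t by (auto simp: pieces_0)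
      have "(t, Suc 0, Some (u / t 0)) \<in> pieces"
        using u t base1_nz[OF t] by (auto simp: pieces_1)
      moreover have "psi (t, Suc 0, Some (u / t 0)) = (t, x)"
        using u base1_nz[OF t] by (auto simp: psi_def)
      ultimately show ?thesis by force
    qed
  qed
qed

text \<open>Glued points have x = \<open>koebe\<close> u and y = 1/v with u v = t, hence u = t y,
  which is the formula by which \<open>psi\<close> maps the second sphere into the first.\<close>

lemma plumb_rel_psi:
  assumes "(p, q) \<in> plumb_rel 0 4 z_coord w_coord"
  shows "p \<in> pieces" "q \<in> pieces" "psi p = psi q"
proof -
  obtain t i u v where tuv: "p = (t, z_coord i u)" "q = (t, w_coord i v)" "t \<in> base1"
    "norm (t 0) < norm u" "norm u < 1" "norm (t 0) < norm v" "norm v < 1" "u * v = t 0"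
    using assms by (auto simp: plumb_rel_def)
  have "v \<noteq> 0" using tuv base1_nz by auto
  then have v: "v \<noteq> 0" "u = t 0 * inverse v" by (simp_all flip: tuv(8))
  show "p \<in> pieces" using tuv by (auto simp: z_coord_def pieces_0 koebe_eq_iff)
  have q: "q = (t, Suc 0, Some (inverse v))" using v by (simp add: tuv(2) w_coord_def sphere_param_def inv_if_def)
  have "norm (t 0 * inverse v) < 1" using tuv(5) v(2) by simp
  then have "(t, Suc 0, Some (inverse v)) \<in> pieces" using tuv(3) by (simp add: pieces_1)
  then show "q \<in> pieces" by (simp add: q)
  have "psi (t, Suc 0, Some (inverse v)) = (t, Some (koebe u))" using v by (simp add: psi_def)
  then show "psi p = psi q" by (simp add: q tuv(1) psi_def z_coord_def)
qed

text \<open>The gluing coordinates are recovered as u = t y and v = 1/y. That x survives in the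
  first piece gives |t| < |u|, equivalently |v| < 1; that y survives in the second gives |u| < 1,
  equivalently |t| < |v|.\<close>

lemma plumb_rel_psi_eq:
  assumes p: "(t, 0, x) \<in> pieces" and q: "(t', Suc 0, x') \<in> pieces" and eq: "psi (t, 0, x) = psi (t', Suc 0, x')"
  shows "((t, 0, x), (t', Suc 0, x')) \<in> plumb_rel 0 4 z_coord w_coord"
proof -
  have t: "t' = t" using eq by (auto simp: psi_def)
  obtain y where y: "x' = Some y" "norm (t 0 * y) < 1" using q t by (auto simp: pieces_1)
  have x: "x = Some (koebe (t 0 * y))" using eq y t by (auto simp: psi_def)
  have tb: "t \<in> base1" using p by (auto simp: pieces_0)
  note nz = base1_nz[OF tb]
  have gt: "norm (t 0) < norm (t 0 * y)" using p x by (auto simp: pieces_0 not_le)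
  then have y1: "norm y > 1" using nz by (simp add: norm_mult)
  then have y0: "y \<noteq> 0" by auto
  have "norm (t 0) < norm (inverse y)"
    using y(2) y0 by (simp add: norm_mult norm_divide inverse_eq_divide pos_less_divide_eq)
  moreover have "norm (inverse y) < 1" using y1 by (simp add: norm_inverse inverse_less_1_iff)
  moreover have "(t, 0, x) = (t, z_coord 0 (t 0 * y))" by (simp add: z_coord_def x)
  moreover have "(t', Suc 0, x') = (t, w_coord 0 (inverse y))" by (simp add: w_coord_def y t sphere_param_def inv_if_def y0)
  moreover have "t 0 * y * inverse y = t 0" using y0 by simp
  ultimately show ?thesis
    unfolding plumb_rel_def using tb gt y(2) by (simp, blast)
qed

text \<open>Since \<open>psi\<close> is injective on each component, two distinct points with the
  same image lie on different components and are related by a single gluing step. The transitive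
  closure thus adds nothing.\<close>

lemma plumb_class_eq:
  assumes q: "q \<in> pieces"
  shows "plumb_class 0 4 z_coord w_coord q = glued (psi q)"
proof -
  let ?R = "plumb_rel 0 4 z_coord w_coord \<union> (plumb_rel 0 4 z_coord w_coord)\<inverse>"
  have "p \<in> pieces \<and> psi p = psi q" if "(q, p) \<in> ?R\<^sup>*" for p
    using that
  proof (induction rule: rtrancl_induct)
    case base
    then show ?case using q by simp
  next
    case (step y z)
    then show ?case using plumb_rel_psi[of y z] plumb_rel_psi[of z y] by force
  qed
  moreover have "(q, p) \<in> ?R\<^sup>*" if p: "p \<in> pieces" and eq: "psi p = psi q" for p
  proof -
    obtain t k x where p': "p = (t, k, x)" by (cases p) auto
    obtain t' k' x' where q': "q = (t', k', x')" by (cases q) auto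
    have t: "t' = t" using eq by (auto simp: p' q' psi_def)
    have k: "k = 0 \<or> k = Suc 0" "k' = 0 \<or> k' = Suc 0" using p q pieces_comp by (auto simp: p' q')
    consider "k = k'" | "k = 0" "k' = Suc 0" | "k = Suc 0" "k' = 0" using k by auto
    then show ?thesis
    proof cases
      case 1
      have "x = x'"
      proof (cases "k = 0")
        case True
        then show ?thesis using eq 1 by (auto simp: p' q' psi_def)
      next
        case False
        then have k: "k = Suc 0" "k' = Suc 0" using k 1 by auto
        obtain y y' where y: "x = Some y" "norm (t 0 * y) < 1" "x' = Some y'" "norm (t 0 * y') < 1" "t \<in> base1"
          using p q t by (auto simp: p' q' k pieces_1)
        have "koebe (t 0 * y) = koebe (t 0 * y')" using eq y t by (auto simp: p' q' psi_def k)
        then show ?thesis using y base1_nz[of t] by (simp add: koebe_eq_iff)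
      qed
      then show ?thesis using 1 t by (simp add: p' q')
    next
      case 2
      then show ?thesis using plumb_rel_psi_eq[of t x t' x'] p q eq by (auto simp: p' q')
    next
      case 3
      then show ?thesis using plumb_rel_psi_eq[of t' x' t x] p q eq by (auto simp: p' q')
    qed
  qed
  ultimately have "(q, p) \<in> ?R\<^sup>* \<longleftrightarrow> p \<in> pieces \<and> psi p = psi q" for p
    by blast
  then show ?thesis unfolding plumb_class_def glued_def Image_singleton by simp
qed

lemma glued_nonempty: "t \<in> base1 \<Longrightarrow> glued (t, x) \<noteq> {}"
proof -
  assume "t \<in> base1"
  then have "(t, x) \<in> psi ` pieces" by (simp add: psi_image)
  then show ?thesis by (force simp: glued_def)
qed

lemma inj_on_glued: "inj_on glued (base1 \<times> UNIV)"
proof (rule inj_onI)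
  fix p q assume p: "p \<in> base1 \<times> UNIV" and eq: "glued p = glued q"
  obtain x where "x \<in> glued p" using glued_nonempty p by fastforce
  then have "psi x = p" "psi x = q" using eq by (auto simp: glued_def)
  then show "p = q" by simp
qed

lemma glued_eq_iff: "t \<in> base1 \<Longrightarrow> t' \<in> base1 \<Longrightarrow> glued (t, x) = glued (t', x') \<longleftrightarrow> t = t' \<and> x = x'"
  using inj_on_eq_iff[OF inj_on_glued, of "(t, x)" "(t', x')"] by simp

definition sphere_fam :: "tpoint set fam" where
  "sphere_fam = plumbing_family 0 4 two_spheres z_coord w_coord"

lemma sphere_fam_simps [simp]: "bdim sphere_fam = Suc 0" "base sphere_fam = base1"
  by (simp_all add: sphere_fam_def plumbing_family_def)

lemma points_sphere_fam: "points sphere_fam = glued ` (base1 \<times> UNIV)"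
proof -
  have "points sphere_fam = (\<lambda>q. glued (psi q)) ` pieces"
    by (auto simp: sphere_fam_def plumbing_family_def pieces_def[symmetric] plumb_class_eq)
  then show ?thesis by (simp flip: psi_image add: image_image)
qed

lemma proj_sphere_fam:
  assumes "t \<in> base1"
  shows "proj sphere_fam (glued (t, x)) = t"
proof -
  have "fst ` glued (t, x) = {t}"
  proof -
    have "fst q = t" if "q \<in> glued (t, x)" for q
      using that by (auto simp: glued_def psi_def case_prod_beta)
    then show ?thesis using glued_nonempty[OF assms, of x] by blast
  qed
  then show ?thesis by (simp add: sphere_fam_def plumbing_family_def)
qed

lemma mark_sphere_fam:
  assumes "t \<in> base1" "j < 4"
  shows "mark sphere_fam j t = glued (t, [None, Some (- (8/7)), Some (koebe (- t 0)), Some (koebe (t 0))] ! j)"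
proof -
  have nz: "t 0 \<noteq> 0" "norm (t 0) < 1" using base1_nz[OF assms(1)] by auto
  have m: "(t, leg two_spheres j) \<in> pieces"
    using assms nz koebe_neq_mark
    by (auto simp: two_spheres_def pieces_0 pieces_1) (metis le_less_trans)
  have "j = 0 \<or> j = 1 \<or> j = 2 \<or> j = 3" using assms(2) by auto
  then have "psi (t, leg two_spheres j) = (t, [None, Some (- (8/7)), Some (koebe (- t 0)), Some (koebe (t 0))] ! j)"
    by (auto simp: two_spheres_def psi_def)
  then show ?thesis
    using plumb_class_eq[OF m] by (simp add: sphere_fam_def plumbing_family_def)
qed

section \<open>Charts in normal form\<close>

definition chart_point :: "nat \<Rightarrow> bool \<Rightarrow> complex \<times> complex \<Rightarrow> tpoint set" where
  "chart_point k r p = glued (vec1 (snd p), param_val k r p)"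

text \<open>Charts of the quotient are given by choosing representatives in an arbitrary set
  \<open>Q\<close>. This form replaces them by an open set \<open>N\<close> of pairs (coordinate,
  parameter) and is all that later arguments use about a chart.\<close>

definition normal_chart :: "nat \<Rightarrow> bool \<Rightarrow> (complex \<times> complex) set \<Rightarrow> tpoint set set \<Rightarrow> (tpoint set \<Rightarrow> complex) \<Rightarrow> bool" where
  "normal_chart k r N U \<eta> \<longleftrightarrow> open N \<and> N \<subseteq> param_dom k r \<and> U = chart_point k r ` N \<and> (\<forall>p\<in>N. \<eta> (chart_point k r p) = fst p)"

lemma vec1_base1_iff: "vec1 t \<in> base1 \<longleftrightarrow> 0 < norm t \<and> norm t < 1"
  by (auto simp: punctured_polydisc_1)

lemma base1_vec1: "s \<in> base1 \<Longrightarrow> vec1 (s 0) = s"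
  by (auto simp: punctured_polydisc_1)

lemma param_dom_base1: "(a, t) \<in> param_dom k r \<Longrightarrow> vec1 t \<in> base1"
  by (auto simp: param_dom_def vec1_base1_iff)

lemma chart_point_eq_iff:
  assumes "(a, t) \<in> param_dom k r" "(a', t') \<in> param_dom k' r'"
  shows "chart_point k r (a, t) = chart_point k' r' (a', t') \<longleftrightarrow> t = t' \<and> param_val k r (a, t) = param_val k' r' (a', t')"
  using glued_eq_iff[OF param_dom_base1[OF assms(1)] param_dom_base1[OF assms(2)]] by (simp add: chart_point_def)

lemma sphere_charts_sphere_param:
  assumes "(V, \<zeta>) \<in> sphere_charts"
  obtains r where "\<And>a. sphere_param r a \<in> V" "\<And>a. \<zeta> (sphere_param r a) = a" "\<And>x. x \<in> V \<Longrightarrow> sphere_param r (\<zeta> x) = x"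
proof -
  consider "V = - {None}" "\<zeta> = the" | "V = - {Some 0}" "\<zeta> = case_option 0 inverse"
    using assms by (auto simp: sphere_charts_def)
  then show thesis
  proof cases
    case 1
    show ?thesis by (rule that[of False]) (auto simp: 1 sphere_param_def inv_if_def)
  next
    case 2
    show ?thesis by (rule that[of True]) (auto simp: 2 sphere_param_def inv_if_def split: option.splits)
  qed
qed

lemma psi_sphere_param:
  assumes "(vec1 t, k, sphere_param r a) \<in> pieces"
  shows "(a, t) \<in> param_dom k r" "psi (vec1 t, k, sphere_param r a) = (vec1 t, param_val k r (a, t))"
proof -
  have t: "0 < norm t" "norm t < 1"
    using assms by (auto simp: pieces_def plumb_pieces_def vec1_base1_iff)
  have k: "k = 0 \<or> k = Suc 0 \<and> (\<exists>y. sphere_param r a = Some y \<and> norm (t * y) < 1)"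
    using pieces_comp[OF assms] assms by (auto simp: pieces_1)
  then show "(a, t) \<in> param_dom k r" using t by (auto simp: param_dom_def sphere_param_eq_Some)
  show "psi (vec1 t, k, sphere_param r a) = (vec1 t, param_val k r (a, t))"
    using k by (auto simp: psi_def param_val_def sphere_param_eq_Some)
qed

text \<open>It makes \<open>the_elem\<close> meaningful in the charts: a class meets
  \<open>Q\<close> in exactly one representative.\<close>

lemma glued_Int_eq:
  assumes "Q \<subseteq> pieces" "inj_on (\<lambda>q. glued (psi q)) Q" "q \<in> Q"
  shows "glued (psi q) \<inter> Q = {q}"
proof -
  have "p = q" if "p \<in> Q" "psi p = psi q" for p
    using inj_onD[OF assms(2)] assms(3) that by auto
  then show ?thesis using assms by (auto simp: glued_def)
qed

lemma charts_sphere_fam_iff: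
  "(U, \<eta>) \<in> charts sphere_fam \<longleftrightarrow> (\<exists>Q k V \<zeta>. U = (\<lambda>q. glued (psi q)) ` Q \<and> \<eta> = (\<lambda>c. \<zeta> (snd (snd (the_elem (c \<inter> Q))))) \<and>
     k < 2 \<and> (V, \<zeta>) \<in> sphere_charts \<and> Q \<subseteq> {(t, p) \<in> pieces. fst p = k \<and> snd p \<in> V} \<and>
     rel_open (Suc 0) ((\<lambda>(t, p). (\<zeta> (snd p), t)) ` Q) \<and> inj_on (\<lambda>q. glued (psi q)) Q)"
proof -
  have cls: "plumb_class 0 4 z_coord w_coord ` Q = (\<lambda>q. glued (psi q)) ` Q"
    "inj_on (plumb_class 0 4 z_coord w_coord) Q = inj_on (\<lambda>q. glued (psi q)) Q" if "Q \<subseteq> pieces" for Q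
    using that plumb_class_eq by (auto intro!: image_cong inj_on_cong)
  have "(U, \<eta>) \<in> charts sphere_fam \<longleftrightarrow> (\<exists>Q k V \<zeta>. U = plumb_class 0 4 z_coord w_coord ` Q \<and>
     \<eta> = (\<lambda>c. \<zeta> (snd (snd (the_elem (c \<inter> Q))))) \<and>
     k < 2 \<and> (V, \<zeta>) \<in> sphere_charts \<and> Q \<subseteq> {(t, p) \<in> pieces. fst p = k \<and> snd p \<in> V} \<and>
     rel_open (Suc 0) ((\<lambda>(t, p). (\<zeta> (snd p), t)) ` Q) \<and> inj_on (plumb_class 0 4 z_coord w_coord) Q)"
    unfolding sphere_fam_def plumbing_family_def plumb_charts_def pieces_def[symmetric] by simp
  also have "\<dots> \<longleftrightarrow> (\<exists>Q k V \<zeta>. U = (\<lambda>q. glued (psi q)) ` Q \<and> \<eta> = (\<lambda>c. \<zeta> (snd (snd (the_elem (c \<inter> Q))))) \<and>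
     k < 2 \<and> (V, \<zeta>) \<in> sphere_charts \<and> Q \<subseteq> {(t, p) \<in> pieces. fst p = k \<and> snd p \<in> V} \<and>
     rel_open (Suc 0) ((\<lambda>(t, p). (\<zeta> (snd p), t)) ` Q) \<and> inj_on (\<lambda>q. glued (psi q)) Q)"
  proof (intro iff_exI, goal_cases)
    case (1 Q k V \<zeta>)
    show ?case
    proof (cases "Q \<subseteq> {(t, p) \<in> pieces. fst p = k \<and> snd p \<in> V}")
      case True
      then have "Q \<subseteq> pieces" by auto
      then show ?thesis by (simp only: cls)
    next
      case False
      then show ?thesis by blast
    qed
  qed
  finally show ?thesis .
qed

text \<open>\<open>N\<close> is the preimage of \<open>Q\<close> under the inverse of the sphere
  chart; the openness required of \<open>Q\<close> in the definition of the charts is precisely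
  openness of \<open>N\<close>.\<close>

lemma charts_sphere_fam_normal_chart:
  assumes "(U, \<eta>) \<in> charts sphere_fam"
  obtains k r N where "normal_chart k r N U \<eta>"
proof -
  obtain Q k V \<zeta> where Q: "U = (\<lambda>q. glued (psi q)) ` Q" "\<eta> = (\<lambda>c. \<zeta> (snd (snd (the_elem (c \<inter> Q)))))"
    "(V, \<zeta>) \<in> sphere_charts" "Q \<subseteq> {(t, p) \<in> pieces. fst p = k \<and> snd p \<in> V}"
    "rel_open (Suc 0) ((\<lambda>(t, p). (\<zeta> (snd p), t)) ` Q)" "inj_on (\<lambda>q. glued (psi q)) Q"
    using assms unfolding charts_sphere_fam_iff by blast
  obtain r where r: "\<And>a. sphere_param r a \<in> V" "\<And>a. \<zeta> (sphere_param r a) = a" "\<And>x. x \<in> V \<Longrightarrow> sphere_param r (\<zeta> x) = x"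
    using sphere_charts_sphere_param[OF Q(3)] by metis
  define N where "N = {(a, t). (vec1 t, k, sphere_param r a) \<in> Q}"
  define i where "i = (\<lambda>(a, t). (vec1 t, k, sphere_param r a))"
  have QP: "Q \<subseteq> pieces" using Q(4) by auto
  have QN: "Q = i ` N"
  proof
    show "Q \<subseteq> i ` N"
    proof
      fix q assume q: "q \<in> Q"
      obtain t x where tx: "q = (t, k, x)" "x \<in> V" "t \<in> base1"
        using q Q(4) by (cases q) (auto simp: pieces_def plumb_pieces_def)
      then have "q = i (\<zeta> x, t 0)" by (simp add: i_def r base1_vec1)
      then show "q \<in> i ` N" using q by (auto simp: i_def N_def)
    qed
  qed (auto simp: N_def i_def)
  have "(\<lambda>(t, p). (\<zeta> (snd p), t)) ` Q = lift ` N"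
    unfolding QN image_image by (rule image_cong) (auto simp: i_def lift_def r)
  then have "open N" using Q(5) by (simp add: rel_open_1_lift)
  have iN: "i p \<in> Q" if "p \<in> N" for p using that QN by blast
  have N: "(a, t) \<in> param_dom k r" "psi (i (a, t)) = (vec1 t, param_val k r (a, t))" if "(a, t) \<in> N" for a t
    using psi_sphere_param[of t k r a] iN[OF that] QP by (auto simp: i_def)
  have chart_point: "chart_point k r p = glued (psi (i p))" if "p \<in> N" for p
    using N that by (cases p) (simp add: chart_point_def)
  have "normal_chart k r N U \<eta>"
    unfolding normal_chart_def
  proof (intro conjI ballI)
    show "N \<subseteq> param_dom k r" using N by auto
    show "U = chart_point k r ` N" unfolding Q(1) QN image_image by (rule image_cong) (simp_all add: chart_point)
    show "\<eta> (chart_point k r p) = fst p" if "p \<in> N" for p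
      using glued_Int_eq[OF QP Q(6) iN[OF that]] that r by (cases p) (simp add: chart_point Q(2) i_def)
  qed fact
  then show thesis by (rule that)
qed

text \<open>The disc removed from the first sphere must be closed jointly in coordinate and
  parameter. Clearing denominators in a = \<open>koebe\<close> u, or in 1/a = \<open>koebe\<close>
  u, gives polynomial equations, and projecting a closed set along the compact disc of
  \<open>u\<close> keeps it closed.\<close>

lemma closed_koebe_graph:
  "closed {(a, t::complex). \<exists>u. norm u \<le> \<rho> \<and> norm u \<le> norm t \<and>
     (if r then a * u = (1 - u)\<^sup>2 else a * (1 - u)\<^sup>2 = (u::complex))}"
proof -
  let ?T = "{(u, a, t::complex). norm u \<le> norm t \<and> (if r then a * u = (1 - u)\<^sup>2 else a * (1 - u)\<^sup>2 = (u::complex))}"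
  have "closed ?T"
  proof (cases r)
    case True
    then show ?thesis unfolding case_prod_beta
      by (simp, intro closed_Collect_conj closed_Collect_le closed_Collect_eq continuous_intros)
  next
    case False
    then show ?thesis unfolding case_prod_beta
      by (simp, intro closed_Collect_conj closed_Collect_le closed_Collect_eq continuous_intros)
  qed
  from closed_compact_projection[OF compact_cball[of 0 \<rho>] this]
  have "closed {y. \<exists>x. x \<in> cball 0 \<rho> \<and> (x, y) \<in> ?T}" .
  moreover have "{y. \<exists>x. x \<in> cball 0 \<rho> \<and> (x, y) \<in> ?T} = {(a, t). \<exists>u. norm u \<le> \<rho> \<and> norm u \<le> norm t \<and>
     (if r then a * u = (1 - u)\<^sup>2 else a * (1 - u)\<^sup>2 = (u::complex))}"
    by auto
  ultimately show ?thesis by simp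
qed

lemma open_pieces_0: "open {(a, t). (vec1 t, 0, sphere_param r a) \<in> pieces}"
proof -
  let ?C = "\<lambda>\<rho>. {(a, t). \<exists>u. norm u \<le> \<rho> \<and> norm u \<le> norm t \<and>
     (if r then a * u = (1 - u)\<^sup>2 else a * (1 - u)\<^sup>2 = (u::complex))}"
  have eq: "sphere_param r a = Some (koebe u) \<longleftrightarrow> (if r then a * u = (1 - u)\<^sup>2 else a * (1 - u)\<^sup>2 = u)" if "norm u < 1" for a u
  proof -
    have "1 - u \<noteq> 0" using norm_less_1_neq_1[OF that] .
    then show ?thesis
      by (auto simp: sphere_param_def inv_if_def koebe_def inverse_eq_divide divide_simps mult.commute)
  qed
  have eq: "{(a, t). (vec1 t, 0, sphere_param r a) \<in> pieces} = (\<Union>\<rho>\<in>{0<..<1}. (UNIV \<times> {t. 0 < norm t \<and> norm t < \<rho>}) - ?C \<rho>)"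
    (is "?L = ?R")
  proof (intro subset_antisym subsetI)
    fix p assume "p \<in> ?L"
    then obtain a t where p: "p = (a, t)" "0 < norm t" "norm t < 1" "\<And>u. norm u \<le> norm t \<Longrightarrow> sphere_param r a \<noteq> Some (koebe u)"
      by (auto simp: pieces_0 vec1_base1_iff)
    \<comment> \<open>A radius between |t| and 1 confines \<open>u\<close> to one compact disc for
      all nearby parameters.\<close>
    obtain \<rho> where \<rho>: "norm t < \<rho>" "\<rho> < 1" using dense[OF p(3)] by blast
    have "\<not> (if r then a * u = (1 - u)\<^sup>2 else a * (1 - u)\<^sup>2 = u)" if "norm u \<le> norm t" for u
      using p(4)[OF that] eq[of u a] that p(3) by simp
    then have C: "p \<notin> ?C \<rho>" unfolding p(1) by blast
    have "\<rho> \<in> {0<..<1}" using \<rho> less_trans[OF p(2) \<rho>(1)] by simp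
    then show "p \<in> ?R" by (rule UN_I) (use C p \<rho> in simp)
  next
    fix p assume "p \<in> ?R"
    then obtain \<rho> where \<rho>: "\<rho> \<in> {0<..<1}" "p \<in> UNIV \<times> {t. 0 < norm t \<and> norm t < \<rho>}" "p \<notin> ?C \<rho>" by blast
    obtain a t where at: "p = (a, t)" by (cases p)
    have p: "p = (a, t)" "\<rho> < 1" "0 < norm t" "norm t < \<rho>" using \<rho>(1,2) by (auto simp: at)
    have C: "\<not> (if r then a * u = (1 - u)\<^sup>2 else a * (1 - u)\<^sup>2 = u)" if "norm u \<le> \<rho>" "norm u \<le> norm t" for u
      using \<rho>(3) that unfolding p(1) by blast
    have "sphere_param r a \<noteq> Some (koebe u)" if "norm u \<le> norm t" for u
      using C[of u] p that eq[of u a] by simp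
    moreover have "norm t < 1" using p by linarith
    ultimately show "p \<in> ?L" using p by (auto simp: pieces_0 vec1_base1_iff)
  qed
  have op: "open {t::complex. 0 < norm t \<and> norm t < \<rho>}" for \<rho>
    by (intro open_Collect_conj open_Collect_less continuous_intros)
  show ?thesis
    unfolding eq by (intro open_UN ballI open_Diff open_Times open_UNIV op closed_koebe_graph)
qed

lemma open_pieces: "open {(a, t). (vec1 t, k, sphere_param r a) \<in> pieces}"
proof (cases "k = 0 \<or> k = Suc 0")
  case True
  have "{(a, t). (vec1 t, Suc 0, sphere_param r a) \<in> pieces} = param_dom (Suc 0) r"
    by (auto simp: pieces_1 param_dom_def vec1_base1_iff sphere_param_eq_Some)
  then show ?thesis using True open_pieces_0 open_param_dom by auto
next
  case False
  then have "{(a, t). (vec1 t, k, sphere_param r a) \<in> pieces} = {}" using pieces_comp by auto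
  then show ?thesis by simp
qed

text \<open>The largest possible \<open>Q\<close> works: all of one component that lies in the
  domain of a sphere chart, since the quotient map is injective on a whole component.\<close>

lemma charts_sphere_fam_cover:
  assumes "t \<in> base1"
  obtains U \<eta> where "(U, \<eta>) \<in> charts sphere_fam" "glued (t, x) \<in> U"
proof -
  obtain q where q: "q \<in> pieces" "psi q = (t, x)" 
  proof -
    have "(t, x) \<in> psi ` pieces" using assms by (simp add: psi_image)
    then show thesis using that by (metis imageE)
  qed
  obtain t' k y where q': "q = (t', k, y)" by (cases q) auto
  have k: "k = 0 \<or> k = Suc 0" using q pieces_comp q' by auto
  obtain V \<zeta> where V: "(V, \<zeta>) \<in> sphere_charts" "y \<in> V"
    by (cases "y = None") (auto simp: sphere_charts_def)
  obtain r where r: "\<And>a. sphere_param r a \<in> V" "\<And>a. \<zeta> (sphere_param r a) = a" "\<And>x. x \<in> V \<Longrightarrow> sphere_param r (\<zeta> x) = x"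
    using sphere_charts_sphere_param[OF V(1)] by metis
  define Q where "Q = {(t, p) \<in> pieces. fst p = k \<and> snd p \<in> V}"
  have "(\<lambda>(t, p). (\<zeta> (snd p), t)) ` Q = lift ` {(a, t). (vec1 t, k, sphere_param r a) \<in> pieces}" (is "?L = ?R")
  proof
    show "?L \<subseteq> ?R"
    proof
      fix z assume "z \<in> ?L"
      then obtain s w where "(s, k, w) \<in> pieces" "w \<in> V" "z = (\<zeta> w, s)" by (auto simp: Q_def)
      moreover from this have "s \<in> base1" by (auto simp: pieces_def plumb_pieces_def)
      ultimately have "z = lift (\<zeta> w, s 0)" "(vec1 (s 0), k, sphere_param r (\<zeta> w)) \<in> pieces"
        using r base1_vec1 by (auto simp: lift_def)
      then show "z \<in> ?R" by blast
    qed
    show "?R \<subseteq> ?L"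
    proof
      fix z assume "z \<in> ?R"
      then obtain a t where at: "(vec1 t, k, sphere_param r a) \<in> pieces" "z = (a, vec1 t)"
        by (auto simp: lift_def)
      have "(vec1 t, k, sphere_param r a) \<in> Q" using at(1) r(1) by (simp add: Q_def)
      then show "z \<in> ?L" by (rule rev_image_eqI) (simp add: at r)
    qed
  qed
  then have ro: "rel_open (Suc 0) ((\<lambda>(t, p). (\<zeta> (snd p), t)) ` Q)"
    by (simp add: rel_open_1_lift open_pieces)
  have "inj_on psi Q"
  proof (rule inj_onI)
    fix p p' assume p: "p \<in> Q" "p' \<in> Q" "psi p = psi p'"
    obtain s w where w: "p = (s, k, w)" "(s, k, w) \<in> pieces" using p by (auto simp: Q_def)
    obtain s' w' where w': "p' = (s', k, w')" "(s', k, w') \<in> pieces" using p by (auto simp: Q_def)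
    have s: "s' = s" using p(3) by (auto simp: w w' psi_def)
    show "p = p'"
    proof (cases "k = 0")
      case True
      then show ?thesis using p(3) by (simp add: w w' psi_def)
    next
      case False
      then have "k = Suc 0" using k by simp
      then obtain v v' where v: "w = Some v" "norm (s 0 * v) < 1" "w' = Some v'" "norm (s 0 * v') < 1" "s \<in> base1"
        using w w' s by (auto simp: pieces_1)
      then have "koebe (s 0 * v) = koebe (s 0 * v')" using p(3) False s by (auto simp: w w' psi_def)
      then show ?thesis using v base1_nz[of s] by (simp add: koebe_eq_iff w w' s)
    qed
  qed
  then have "inj_on (\<lambda>q. glued (psi q)) Q"
  proof (rule comp_inj_on[of psi Q glued, unfolded comp_def])
    show "inj_on glued (psi ` Q)"
      by (rule inj_on_subset[OF inj_on_glued]) (auto simp: Q_def simp flip: psi_image)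
  qed
  then have "((\<lambda>q. glued (psi q)) ` Q, (\<lambda>c. \<zeta> (snd (snd (the_elem (c \<inter> Q)))))) \<in> charts sphere_fam"
    unfolding charts_sphere_fam_iff using k V ro Q_def by (intro exI[of _ Q] exI[of _ k] exI[of _ V] exI[of _ \<zeta>]) auto
  moreover have "glued (t, x) \<in> (\<lambda>q. glued (psi q)) ` Q"
    using q V by (intro image_eqI[of _ _ q]) (auto simp: Q_def q')
  ultimately show thesis by (rule that)
qed

lemma chart_point_in_points: "p \<in> param_dom k r \<Longrightarrow> chart_point k r p \<in> points sphere_fam"
  by (cases p) (auto simp: chart_point_def points_sphere_fam dest: param_dom_base1)

lemma coord_chart_point: "normal_chart k r N U \<eta> \<Longrightarrow> p \<in> N \<Longrightarrow> coord sphere_fam \<eta> (chart_point k r p) = lift p"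
  by (cases p) (auto simp: normal_chart_def coord_def chart_point_def lift_def intro!: proj_sphere_fam param_dom_base1)

lemma coord_image_chart_point:
  assumes "normal_chart k r N U \<eta>" "M \<subseteq> N"
  shows "coord sphere_fam \<eta> ` chart_point k r ` M = lift ` M"
  unfolding image_image using assms by (intro image_cong) (auto simp: coord_chart_point)

lemma normal_chart_inj:
  assumes "normal_chart k r N U \<eta>"
  shows "inj_on (coord sphere_fam \<eta>) U"
proof (rule inj_onI)
  fix x y assume "x \<in> U" "y \<in> U" and eq: "coord sphere_fam \<eta> x = coord sphere_fam \<eta> y"
  then obtain p q where "p \<in> N" "x = chart_point k r p" "q \<in> N" "y = chart_point k r q"
    using assms by (auto simp: normal_chart_def)
  then show "x = y" using eq coord_chart_point[OF assms] by simp
qed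

lemma inv_coord_chart_point:
  assumes "normal_chart k r N U \<eta>" "p \<in> N"
  shows "inv_into U (coord sphere_fam \<eta>) (lift p) = chart_point k r p"
  using inv_into_f_f[OF normal_chart_inj[OF assms(1)], of "chart_point k r p"] coord_chart_point[OF assms] assms
  by (simp add: normal_chart_def)

text \<open>The first parametrisation need not come from a chart of the atlas, only from
  \<open>param_dom\<close>. This allows the full first sphere to be used as a coordinate later
  on.\<close>

lemma chart_point_transition:
  assumes p: "p \<in> param_dom k r" and N': "open N'" "N' \<subseteq> param_dom k' r'" "p' \<in> N'" and eq: "chart_point k r p = chart_point k' r' p'"
  obtains T where "hol2 T p" "T p = fst p'"
    "\<forall>\<^sub>F q in nhds p. q \<in> param_dom k r \<and> (T q, snd q) \<in> N' \<and> chart_point k r q = chart_point k' r' (T q, snd q)"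
proof -
  obtain a t where at: "p = (a, t)" by (cases p)
  obtain a' t' where at': "p' = (a', t')" by (cases p')
  have t': "t' = t" and kv: "param_val k r (a, t) = param_val k' r' (a', t)"
    using chart_point_eq_iff[of a t k r a' t' k' r'] p N' eq by (auto simp: at at')
  obtain T where T: "hol2 T (a, t)" "T (a, t) = a'"
    "\<forall>\<^sub>F p in nhds (a, t). (T p, snd p) \<in> param_dom k' r' \<and> param_val k' r' (T p, snd p) = param_val k r p"
    using param_val_transition[of a t k r a' k' r'] p N' kv by (auto simp: at at' t')
  have "((\<lambda>q. (T q, snd q)) \<longlongrightarrow> (T p, snd p)) (nhds p)"
    by (intro tendsto_Pair hol2_tendsto tendsto_snd filterlim_ident) (simp add: at T)
  moreover have "(T p, snd p) \<in> N'" using N' T by (simp add: at at' t')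
  ultimately have "\<forall>\<^sub>F q in nhds p. (T q, snd q) \<in> N'"
    using N'(1) topological_tendstoD by blast
  moreover have "\<forall>\<^sub>F q in nhds p. q \<in> param_dom k r"
    using p open_param_dom by (simp add: eventually_nhds_in_open)
  ultimately have "\<forall>\<^sub>F q in nhds p. q \<in> param_dom k r \<and> (T q, snd q) \<in> N' \<and> chart_point k r q = chart_point k' r' (T q, snd q)"
    using T(3) unfolding at[symmetric] by eventually_elim (simp add: chart_point_def)
  then show thesis using T by (intro that[of T]) (simp_all add: at at')
qed

lemma holomorphic_atlas_sphere_fam: "holomorphic_atlas sphere_fam"
proof -
  have un: "(\<Union>(U, \<zeta>)\<in>charts sphere_fam. U) = points sphere_fam"
  proof
    show "(\<Union>(U, \<zeta>)\<in>charts sphere_fam. U) \<subseteq> points sphere_fam"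
    proof clarify
      fix U \<zeta> x assume "(U, \<zeta>) \<in> charts sphere_fam" "x \<in> U"
      then obtain k r N where "normal_chart k r N U \<zeta>" using charts_sphere_fam_normal_chart by metis
      then show "x \<in> points sphere_fam" using \<open>x \<in> U\<close> chart_point_in_points by (auto simp: normal_chart_def)
    qed
    show "points sphere_fam \<subseteq> (\<Union>(U, \<zeta>)\<in>charts sphere_fam. U)"
    proof
      fix c assume "c \<in> points sphere_fam"
      then obtain t x where "c = glued (t, x)" "t \<in> base1" by (auto simp: points_sphere_fam)
      then show "c \<in> (\<Union>(U, \<zeta>)\<in>charts sphere_fam. U)" using charts_sphere_fam_cover[of t x] by blast
    qed
  qed
  have one: "inj_on (coord sphere_fam \<zeta>) U \<and> rel_open (Suc 0) (coord sphere_fam \<zeta> ` U)" if c: "(U, \<zeta>) \<in> charts sphere_fam" for U \<zeta>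
  proof -
    obtain k r N where n: "normal_chart k r N U \<zeta>" using charts_sphere_fam_normal_chart[OF c] .
    then have "coord sphere_fam \<zeta> ` U = lift ` N" "open N" using coord_image_chart_point[OF n order_refl] by (auto simp: normal_chart_def)
    then show ?thesis using normal_chart_inj[OF n] by (simp add: rel_open_1_lift)
  qed
  have two: "rel_open (Suc 0) (coord sphere_fam \<zeta> ` (U \<inter> V)) \<and>
      holo_prod (Suc 0) (coord sphere_fam \<zeta> ` (U \<inter> V)) (\<lambda>x. \<xi> (inv_into U (coord sphere_fam \<zeta>) x))"
    if c: "(U, \<zeta>) \<in> charts sphere_fam" "(V, \<xi>) \<in> charts sphere_fam" for U \<zeta> V \<xi>
  proof -
    obtain k r N where n: "normal_chart k r N U \<zeta>" using charts_sphere_fam_normal_chart[OF c(1)] .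
    obtain k' r' N' where n': "normal_chart k' r' N' V \<xi>" using charts_sphere_fam_normal_chart[OF c(2)] .
    define M where "M = {p \<in> N. chart_point k r p \<in> V}"
    have MN: "M \<subseteq> N" by (auto simp: M_def)
    have UV: "U \<inter> V = chart_point k r ` M" using n by (auto simp: M_def normal_chart_def)
    have *: "hol2 (\<lambda>p. \<xi> (inv_into U (coord sphere_fam \<zeta>) (lift p))) p \<and> (\<forall>\<^sub>F q in nhds p. q \<in> M)" if p: "p \<in> M" for p
    proof -
      obtain p' where p': "p' \<in> N'" "chart_point k r p = chart_point k' r' p'" using p n' by (auto simp: M_def normal_chart_def)
      have pN: "p \<in> param_dom k r" "open N" "p \<in> N" using p n by (auto simp: M_def normal_chart_def)
      obtain T where T: "hol2 T p" "T p = fst p'"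
        "\<forall>\<^sub>F q in nhds p. q \<in> param_dom k r \<and> (T q, snd q) \<in> N' \<and> chart_point k r q = chart_point k' r' (T q, snd q)"
        by (rule chart_point_transition[of p k r N' k' r' p']) (use p' n' \<open>p \<in> param_dom k r\<close> in \<open>auto simp: normal_chart_def\<close>)
      have ev: "\<forall>\<^sub>F q in nhds p. q \<in> N \<and> (T q, snd q) \<in> N' \<and> chart_point k r q = chart_point k' r' (T q, snd q)"
        using eventually_nhds_in_open[OF pN(2,3)] T(3) by eventually_elim auto
      have evM: "\<forall>\<^sub>F q in nhds p. q \<in> M"
        using ev by eventually_elim (use n' in \<open>auto simp: M_def normal_chart_def\<close>)
      have evT: "\<forall>\<^sub>F q in nhds p. T q = \<xi> (inv_into U (coord sphere_fam \<zeta>) (lift q))"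
        using ev
      proof eventually_elim
        case (elim q)
        then show ?case using inv_coord_chart_point[OF n, of q] n' by (auto simp: normal_chart_def)
      qed
      show ?thesis by (intro conjI hol2_cong[OF T(1) evT] evM)
    qed
    have "open M" by (rule eventually_nhds_openI) (use * in blast)
    then show ?thesis
      unfolding UV coord_image_chart_point[OF n MN] rel_open_1_lift using * by (auto intro!: holo_prod_1)
  qed
  show ?thesis
    unfolding holomorphic_atlas_def sphere_fam_simps
  proof (intro conjI un ballI, goal_cases)
    case (1 c)
    then show ?case using one by (cases c) simp
  next
    case (2 c)
    obtain U \<zeta> where c: "c = (U, \<zeta>)" by (cases c)
    show ?case
      unfolding c prod.case
    proof (intro ballI, goal_cases)
      case (1 d)
      then show ?case using two[of U \<zeta>] 2 by (cases d) (simp add: c)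
    qed
  qed
qed

section \<open>The topology of the total space\<close>

text \<open>The product norm on \<open>complex \<times> real\<close> is Euclidean, so this is the
  round 2-sphere. As a model of the fibre it brings compactness, connectedness and homology.\<close>

abbreviation S2 :: "(complex \<times> real) set" where
  "S2 \<equiv> sphere 0 1"

lemma S2_iff: "(w, h) \<in> S2 \<longleftrightarrow> (norm w)\<^sup>2 + h\<^sup>2 = 1"
  by (simp add: norm_Pair)

definition stereo :: "sphere \<Rightarrow> complex \<times> real" where
  "stereo x = (case x of None \<Rightarrow> (0, 1)
     | Some z \<Rightarrow> (of_real (2 / (1 + (norm z)\<^sup>2)) * z, ((norm z)\<^sup>2 - 1) / (1 + (norm z)\<^sup>2)))"

definition unstereo :: "complex \<times> real \<Rightarrow> sphere" where
  "unstereo = (\<lambda>(w, h). if h = 1 then None else Some (w / of_real (1 - h)))"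

text \<open>These are the stereographic projections from the two poles. The conjugate in the one
  from the south pole makes it the reciprocal of the other, matching the chart at infinity.\<close>

definition scoord :: "bool \<Rightarrow> complex \<times> real \<Rightarrow> complex" where
  "scoord r = (\<lambda>(w, h). if r then cnj w / of_real (1 + h) else w / of_real (1 - h))"

lemma one_plus_norm_sq: "1 + (norm (z::complex))\<^sup>2 \<noteq> 0"
  using zero_le_power2[of "norm z"] by linarith

lemma stereo_in_S2: "stereo x \<in> S2"
proof (cases x)
  case None
  then show ?thesis by (simp add: stereo_def S2_iff)
next
  case (Some z)
  define n where "n = (norm z)\<^sup>2"
  have nz: "1 + n \<noteq> 0" using one_plus_norm_sq by (simp add: n_def)
  have "(norm (of_real (2 / (1 + n)) * z))\<^sup>2 = (2 / (1 + n))\<^sup>2 * n"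
    by (simp only: norm_mult norm_of_real power_mult_distrib power2_abs n_def)
  moreover have "(2 / (1 + n))\<^sup>2 * n + ((n - 1) / (1 + n))\<^sup>2 = 1"
    using nz by (simp add: divide_simps) (simp add: power2_eq_square algebra_simps)
  ultimately show ?thesis unfolding Some stereo_def option.case S2_iff n_def by simp
qed

lemma unstereo_stereo: "unstereo (stereo x) = x"
proof (cases x)
  case None
  then show ?thesis by (simp add: stereo_def unstereo_def)
next
  case (Some z)
  define n where "n = (norm z)\<^sup>2"
  have nz: "1 + n \<noteq> 0" using one_plus_norm_sq by (simp add: n_def)
  have e: "1 - (n - 1) / (1 + n) = 2 / (1 + n)" using nz by (simp add: field_simps)
  have ne: "(n - 1) / (1 + n) \<noteq> 1" using nz by (simp add: field_simps)
  have "of_real (2 / (1 + n)) * z / of_real (2 / (1 + n)) = z"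
    using nz by (intro nonzero_mult_div_cancel_left) (simp add: of_real_eq_0_iff del: of_real_divide of_real_add)
  then show ?thesis
    unfolding Some stereo_def unstereo_def option.case n_def[symmetric] prod.case e using ne by simp
qed

lemma stereo_unstereo:
  assumes "p \<in> S2"
  shows "stereo (unstereo p) = p"
proof -
  obtain w h where p: "p = (w, h)" by (cases p)
  have s: "(norm w)\<^sup>2 + h\<^sup>2 = 1" using assms by (simp only: p S2_iff)
  show ?thesis
  proof (cases "h = 1")
    case True
    then have "w = 0" using s by simp
    then show ?thesis using True by (simp add: p unstereo_def stereo_def)
  next
    case False
    define n where "n = (norm (w / of_real (1 - h)))\<^sup>2"
    have "n = (1 - h\<^sup>2) / (1 - h)\<^sup>2"
      using s by (simp only: n_def norm_divide norm_of_real power_divide power2_abs) (simp add: algebra_simps)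
    also have "\<dots> = (1 + h) / (1 - h)"
      using False by (simp add: divide_simps) (simp add: power2_eq_square algebra_simps)
    finally have n: "1 + n = 2 / (1 - h)" "n - 1 = 2 * h / (1 - h)"
      using False by (simp_all add: field_simps)
    have "2 / (2 / (1 - h)) = 1 - h" by simp
    moreover have "2 * h / (1 - h) / (2 / (1 - h)) = h" using False by simp
    moreover have "of_real (1 - h) * (w / of_real (1 - h)) = w"
      using False by (simp del: of_real_diff)
    ultimately show ?thesis
      unfolding p unstereo_def stereo_def prod.case using False
      by (simp only: if_False option.case n_def[symmetric] n)
  qed
qed

lemma sphere_param_scoord:
  assumes p: "p \<in> S2" and r: "snd p \<noteq> (if r then - 1 else 1)"
  shows "sphere_param r (scoord r p) = unstereo p"
proof -
  obtain w h where wh: "p = (w, h)" by (cases p)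
  have s: "(norm w)\<^sup>2 + h\<^sup>2 = 1" using p by (simp only: wh S2_iff)
  show ?thesis
  proof (cases r)
    case False
    then show ?thesis using r by (simp add: sphere_param_def scoord_def unstereo_def inv_if_def wh)
  next
    case True
    then have h: "h \<noteq> - 1" using r wh by simp
    show ?thesis
    proof (cases "h = 1")
      case True
      then show ?thesis using s \<open>r\<close> by (simp add: wh sphere_param_def scoord_def unstereo_def)
    next
      case False
      \<comment> \<open>Equation of the sphere, factored: it turns the reciprocal of one projection
        into the other.\<close>
      have "(1 - h) * (1 + h) = (norm w)\<^sup>2" using s by (simp add: power2_eq_square algebra_simps)
      moreover have nz: "1 + h \<noteq> 0" "1 - h \<noteq> 0" using h False by auto
      ultimately have w: "w \<noteq> 0" by auto
      have "of_real (1 - h) * of_real (1 + h) = w * cnj w"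
        using \<open>(1 - h) * (1 + h) = (norm w)\<^sup>2\<close> by (metis complex_norm_square of_real_mult)
      then have "inverse (cnj w / of_real (1 + h)) = w / of_real (1 - h)"
        using w nz by (simp add: divide_simps mult.commute del: of_real_add of_real_diff)
      then show ?thesis using \<open>r\<close> False w nz
        by (simp add: wh sphere_param_def scoord_def unstereo_def inv_if_def del: of_real_add of_real_diff)
    qed
  qed
qed

lemma continuous_on_stereo_sphere_param: "continuous_on S (\<lambda>a. stereo (sphere_param r a))"
proof -
  have "continuous_on S (\<lambda>a. (of_real (2 / (1 + (norm a)\<^sup>2)) * a, ((norm a)\<^sup>2 - 1) / (1 + (norm a)\<^sup>2)))"
    using one_plus_norm_sq by (intro continuous_intros) auto
  moreover have "continuous_on S (\<lambda>a. (of_real (2 / (1 + (norm a)\<^sup>2)) * cnj a, (1 - (norm a)\<^sup>2) / (1 + (norm a)\<^sup>2)))"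
    using one_plus_norm_sq by (intro continuous_intros) auto
  \<comment> \<open>Inverting the coordinate conjugates the horizontal part and reverses the height.
    In this form continuity at a = 0, the point at infinity, is visible.\<close>
  moreover have "stereo (sphere_param True a) = (of_real (2 / (1 + (norm a)\<^sup>2)) * cnj a, (1 - (norm a)\<^sup>2) / (1 + (norm a)\<^sup>2))" for a
  proof (cases "a = 0")
    case True
    then show ?thesis by (simp add: stereo_def sphere_param_def)
  next
    case False
    define n where "n = (norm a)\<^sup>2"
    have n: "n > 0" using False by (simp add: n_def)
    have "inverse a = cnj a / of_real n"
      using False complex_norm_square[of a] by (simp add: n_def divide_simps mult.commute)
    moreover have "(norm (inverse a))\<^sup>2 = inverse n" by (simp add: n_def norm_inverse power_inverse)
    moreover have "1 + inverse n = (1 + n) / n" "inverse n - 1 = (1 - n) / n"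
      using n by (simp_all add: field_simps)
    then have "2 / (1 + inverse n) = 2 / (1 + n) * n" "(inverse n - 1) / (1 + inverse n) = (1 - n) / (1 + n)"
      using n by simp_all
    moreover have "of_real (x * n) * (cnj a / of_real n) = of_real x * cnj a" for x
      using n by (simp add: of_real_mult)
    ultimately show ?thesis
      using False unfolding n_def[symmetric] by (simp only: stereo_def sphere_param_def inv_if_def option.case if_True simp_thms if_False n_def[symmetric])
  qed
  ultimately show ?thesis
    by (cases r) (simp_all add: stereo_def sphere_param_def inv_if_def)
qed

lemma continuous_on_stereo_param_val: "continuous_on (param_dom k r) (\<lambda>p. stereo (param_val k r p))"
proof (cases "k = 0")
  case True
  have "continuous_on (param_dom k r) (\<lambda>p. stereo (sphere_param r (fst p)))"
    by (rule continuous_on_compose2[OF continuous_on_stereo_sphere_param[of UNIV]]) (auto intro: continuous_intros)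
  then show ?thesis using True by (simp add: param_val_def case_prod_beta)
next
  case False
  have "hol2 (\<lambda>p. koebe (snd p * inv_if r (fst p))) p" if "p \<in> param_dom k r" for p
  proof -
    have p: "norm (snd p * inv_if r (fst p)) < 1" "r \<Longrightarrow> fst p \<noteq> 0" using that False by (auto simp: param_dom_def)
    have "hol2 (\<lambda>p. inv_if r (fst p)) p"
      by (rule hol2_compose[OF hol2_fst]) (use p in \<open>auto intro: inv_if_field_differentiable\<close>)
    from hol2_mult[OF hol2_snd this] show ?thesis
      by (rule hol2_compose) (rule koebe_field_differentiable[OF p(1)])
  qed
  then have "continuous_on (param_dom k r) (\<lambda>p. koebe (snd p * inv_if r (fst p)))"
    by (intro continuous_at_imp_continuous_on) (auto intro: hol2_isCont)
  then have "continuous_on (param_dom k r) (\<lambda>p. stereo (sphere_param False (koebe (snd p * inv_if r (fst p)))))"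
    by (rule continuous_on_compose2[OF continuous_on_stereo_sphere_param[of UNIV]]) auto
  then show ?thesis using False by (simp add: param_val_def case_prod_beta sphere_param_def inv_if_def)
qed

section \<open>Topological trivialisation of the total space\<close>

definition to_product :: "tpoint set \<Rightarrow> cvec \<times> complex \<times> real" where
  "to_product c = (\<lambda>(t, x). (t, stereo x)) (inv_into (base1 \<times> UNIV) glued c)"

definition from_product :: "cvec \<times> complex \<times> real \<Rightarrow> tpoint set" where
  "from_product = (\<lambda>(t, p). glued (t, unstereo p))"

lemma to_product_glued: "t \<in> base1 \<Longrightarrow> to_product (glued (t, x)) = (t, stereo x)"
  by (simp add: to_product_def inv_into_f_f[OF inj_on_glued])

lemma topspace_fam_top_sphere_fam: "topspace (fam_top sphere_fam) = points sphere_fam"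
proof -
  have "(\<Union>(U, \<zeta>)\<in>charts sphere_fam. U) = points sphere_fam"
    using holomorphic_atlas_sphere_fam by (simp add: holomorphic_atlas_def)
  moreover have "\<Union> {{y \<in> U. coord sphere_fam \<zeta> y \<in> W} | U \<zeta> W. (U, \<zeta>) \<in> charts sphere_fam \<and> open W} = (\<Union>(U, \<zeta>)\<in>charts sphere_fam. U)"
  proof
    show "(\<Union>(U, \<zeta>)\<in>charts sphere_fam. U) \<subseteq> \<Union> {{y \<in> U. coord sphere_fam \<zeta> y \<in> W} | U \<zeta> W. (U, \<zeta>) \<in> charts sphere_fam \<and> open W}"
    proof clarify
      fix U \<zeta> x assume *: "(U, \<zeta>) \<in> charts sphere_fam" "x \<in> U"
      show "x \<in> \<Union> {{y \<in> U. coord sphere_fam \<zeta> y \<in> W} | U \<zeta> W. (U, \<zeta>) \<in> charts sphere_fam \<and> open W}"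
      proof (rule UnionI)
        show "{y \<in> U. coord sphere_fam \<zeta> y \<in> UNIV} \<in> {{y \<in> U. coord sphere_fam \<zeta> y \<in> W} | U \<zeta> W. (U, \<zeta>) \<in> charts sphere_fam \<and> open W}"
          using *(1) open_UNIV by blast
      qed (use * in simp)
    qed
  qed blast
  ultimately show ?thesis by (simp add: fam_top_def)
qed

lemma openin_chart_point:
  assumes c: "(U, \<eta>) \<in> charts sphere_fam" and n: "normal_chart k r N U \<eta>" and M: "open M" "M \<subseteq> N"
  shows "openin (fam_top sphere_fam) (chart_point k r ` M)"
proof -
  have "rel_open (Suc 0) (lift ` M)" using M by (simp add: rel_open_1_lift)
  then obtain W where W: "open W" "lift ` M = (UNIV \<times> Cn (Suc 0)) \<inter> W"
    by (auto simp: rel_open_def openin_open)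
  have "lift p \<in> W \<longleftrightarrow> p \<in> M" for p
  proof -
    have "lift p \<in> UNIV \<times> Cn (Suc 0)" by (cases p) (simp add: lift_def)
    then have "lift p \<in> W \<longleftrightarrow> lift p \<in> lift ` M" unfolding W(2) by simp
    then show ?thesis by auto
  qed
  then have "chart_point k r ` M = {y \<in> U. coord sphere_fam \<eta> y \<in> W}"
    using n M coord_chart_point[OF n] by (auto simp: normal_chart_def)
  then show ?thesis
    unfolding fam_top_def using c W(1) by (intro topology_generated_by_Basis) blast
qed

lemma continuous_map_to_product: "continuous_map (fam_top sphere_fam) (top_of_set (base1 \<times> S2)) to_product"
proof -
  have maps: "to_product \<in> points sphere_fam \<rightarrow> base1 \<times> S2"
    using stereo_in_S2 by (auto simp: points_sphere_fam to_product_glued)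
  have pre: "openin (fam_top sphere_fam) (points sphere_fam \<inter> to_product -` B)" if "openin (top_of_set (base1 \<times> S2)) B" for B
  proof (subst openin_subopen, intro ballI)
    from that obtain W where W: "open W" "B = (base1 \<times> S2) \<inter> W" by (auto simp: openin_open)
    fix c assume c: "c \<in> points sphere_fam \<inter> to_product -` B"
    then obtain t x where tx: "c = glued (t, x)" "t \<in> base1" by (auto simp: points_sphere_fam)
    obtain U \<eta> where U: "(U, \<eta>) \<in> charts sphere_fam" "c \<in> U" using charts_sphere_fam_cover[OF tx(2)] tx(1) by metis
    obtain k r N where n: "normal_chart k r N U \<eta>" using charts_sphere_fam_normal_chart[OF U(1)] .
    have N: "open N" "N \<subseteq> param_dom k r" "U = chart_point k r ` N" using n by (auto simp: normal_chart_def)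
    obtain p where p: "p \<in> N" "c = chart_point k r p" using U N by auto
    define J where "J = (\<lambda>q. (vec1 (snd q), stereo (param_val k r q)))"
    have HJ: "to_product (chart_point k r q) = J q" if "q \<in> N" for q
      using that N(2) param_dom_base1 by (cases q) (auto simp: chart_point_def J_def to_product_glued)
    have "continuous_on N J"
      unfolding J_def
      by (intro continuous_on_Pair continuous_on_subset[OF continuous_on_stereo_param_val N(2)]
          continuous_on_compose2[OF continuous_on_vec1[of UNIV]] continuous_on_snd continuous_on_id) auto
    then have op: "open (N \<inter> J -` W)" using continuous_open_preimage N(1) W(1) by blast
    show "\<exists>T. openin (fam_top sphere_fam) T \<and> c \<in> T \<and> T \<subseteq> points sphere_fam \<inter> to_product -` B"
    proof (intro exI[of _ "chart_point k r ` (N \<inter> J -` W)"] conjI)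
      show "openin (fam_top sphere_fam) (chart_point k r ` (N \<inter> J -` W))" by (rule openin_chart_point[OF U(1) n op]) auto
      show "c \<in> chart_point k r ` (N \<inter> J -` W)" using p c W HJ[OF p(1)] by auto
      show "chart_point k r ` (N \<inter> J -` W) \<subseteq> points sphere_fam \<inter> to_product -` B"
      proof
        fix y assume "y \<in> chart_point k r ` (N \<inter> J -` W)"
        then obtain q where q: "q \<in> N" "J q \<in> W" and y: "y = chart_point k r q" by blast
        have "q \<in> param_dom k r" using q N by auto
        then have "chart_point k r q \<in> points sphere_fam" "J q \<in> base1 \<times> S2"
          using chart_point_in_points param_dom_base1 stereo_in_S2 by (auto simp: J_def) (metis prod.collapse)
        then show "y \<in> points sphere_fam \<inter> to_product -` B" using q W HJ by (simp add: y)
      qed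
    qed
  qed
  show ?thesis
    unfolding continuous_map_openin_preimage_eq topspace_fam_top_sphere_fam topspace_euclidean_subtopology
    using maps pre by blast
qed

text \<open>Subbasic sets suffice. Near a given point the first sphere, read through
  \<open>scoord\<close>, is a coordinate on the fibre, and \<open>chart_point_transition\<close>
  carries it into the chart that defines the subbasic set.\<close>

lemma continuous_map_from_product: "continuous_map (top_of_set (base1 \<times> S2)) (fam_top sphere_fam) from_product"
  unfolding fam_top_def
proof (rule continuous_on_generated_topo)
  have "from_product ` topspace (top_of_set (base1 \<times> S2)) \<subseteq> topspace (fam_top sphere_fam)"
    by (auto simp: from_product_def topspace_fam_top_sphere_fam points_sphere_fam)
  then show "from_product ` topspace (top_of_set (base1 \<times> S2)) \<subseteq>
    \<Union> {{y \<in> U. coord sphere_fam \<zeta> y \<in> W} | U \<zeta> W. (U, \<zeta>) \<in> charts sphere_fam \<and> open W}"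
    by (simp add: fam_top_def)
next
  fix B assume "B \<in> {{y \<in> U. coord sphere_fam \<zeta> y \<in> W} | U \<zeta> W. (U, \<zeta>) \<in> charts sphere_fam \<and> open W}"
  then obtain U \<zeta> W where B: "B = {y \<in> U. coord sphere_fam \<zeta> y \<in> W}" "(U, \<zeta>) \<in> charts sphere_fam" "open W" by blast
  obtain k r N where n: "normal_chart k r N U \<zeta>" using charts_sphere_fam_normal_chart[OF B(2)] .
  have N: "open N" "N \<subseteq> param_dom k r" "U = chart_point k r ` N" using n by (auto simp: normal_chart_def)
  define N' where "N' = N \<inter> lift -` W"
  have N': "open N'" "N' \<subseteq> param_dom k r"
    using N continuous_on_lift B(3) by (auto simp: N'_def intro!: open_Int open_vimage)
  have BN': "B = chart_point k r ` N'"
    using N(3) coord_chart_point[OF n] by (auto simp: B(1) N'_def)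
  show "openin (top_of_set (base1 \<times> S2)) (from_product -` B \<inter> topspace (top_of_set (base1 \<times> S2)))"
  proof (subst openin_subopen, intro ballI)
    fix y assume "y \<in> from_product -` B \<inter> topspace (top_of_set (base1 \<times> S2))"
    then obtain t p where y: "y = (t, p)" "t \<in> base1" "p \<in> S2" "glued (t, unstereo p) \<in> B"
      by (auto simp: from_product_def)
    obtain q' where q': "q' \<in> N'" "glued (t, unstereo p) = chart_point k r q'" using y(4) BN' by auto
    \<comment> \<open>The projection from the south pole is used only at the north pole; either way
      the chosen projection is continuous near \<open>p\<close>.\<close>
    define r0 where "r0 \<longleftrightarrow> snd p = 1"
    define D where "D = base1 \<times> (S2 \<inter> {p. snd p \<noteq> (if r0 then - 1 else 1)})"
    define cc where "cc = (\<lambda>(t::cvec, p). (scoord r0 p, t 0))"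
    have EPcc: "chart_point 0 r0 (cc (s, q)) = glued (s, unstereo q)" "cc (s, q) \<in> param_dom 0 r0" if "(s, q) \<in> D" for s q
      using that sphere_param_scoord[of q r0] base1_vec1[of s] base1_nz[of s]
      by (auto simp: chart_point_def cc_def param_val_def D_def param_dom_def)
    have yD: "(t, p) \<in> D" using y by (auto simp: D_def r0_def)
    obtain T where T: "\<forall>\<^sub>F q in nhds (cc (t, p)). q \<in> param_dom 0 r0 \<and> (T q, snd q) \<in> N' \<and> chart_point 0 r0 q = chart_point k r (T q, snd q)"
      by (rule chart_point_transition[of "cc (t, p)" 0 r0 N' k r q']) (use EPcc[OF yD] N' q' in auto)
    then obtain M where M: "open M" "cc (t, p) \<in> M" "\<And>q. q \<in> M \<Longrightarrow> chart_point 0 r0 q \<in> B"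
      unfolding eventually_nhds BN' by (metis (no_types, lifting) image_eqI)
    have c1: "continuous_on D (\<lambda>y. scoord r0 (snd y))"
    proof (cases r0)
      case True
      then have "1 + snd (snd y) \<noteq> 0" if "y \<in> D" for y using that by (auto simp: D_def)
      then have "continuous_on D (\<lambda>y. cnj (fst (snd y)) / of_real (1 + snd (snd y)))"
        by (intro continuous_intros ballI) (simp_all only: of_real_eq_0_iff not_False_eq_True)
      then show ?thesis using True by (simp add: scoord_def case_prod_beta)
    next
      case False
      then have "1 - snd (snd y) \<noteq> 0" if "y \<in> D" for y using that by (auto simp: D_def)
      then have "continuous_on D (\<lambda>y. fst (snd y) / of_real (1 - snd (snd y)))"
        by (intro continuous_intros ballI) (simp_all only: of_real_eq_0_iff not_False_eq_True)
      then show ?thesis using False by (simp add: scoord_def case_prod_beta)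
    qed
    have c2: "continuous_on D (\<lambda>y. fst y 0)"
      by (rule continuous_on_compose2[OF continuous_on_coord_0[of UNIV]]) (auto intro: continuous_intros)
    have "continuous_on D cc"
      using continuous_on_Pair[OF c1 c2] by (simp add: cc_def case_prod_beta)
    then have "openin (top_of_set D) (D \<inter> cc -` M)" using M(1) continuous_openin_preimage_gen by blast
    moreover have "openin (top_of_set (base1 \<times> S2)) D"
    proof -
      have "open {y::cvec \<times> complex \<times> real. snd (snd y) \<noteq> (if r0 then - 1 else 1)}"
        by (intro open_Collect_neq continuous_intros)
      moreover have "D = (base1 \<times> S2) \<inter> {y. snd (snd y) \<noteq> (if r0 then - 1 else 1)}"
        by (auto simp: D_def)
      ultimately show ?thesis by (auto simp: openin_open)
    qed
    ultimately have "openin (top_of_set (base1 \<times> S2)) (D \<inter> cc -` M)" using openin_trans by blast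
    moreover have "y \<in> D \<inter> cc -` M" using yD M(2) y(1) by simp
    moreover have "D \<inter> cc -` M \<subseteq> from_product -` B \<inter> topspace (top_of_set (base1 \<times> S2))"
    proof
      fix z assume "z \<in> D \<inter> cc -` M"
      then obtain s q where *: "z = (s, q)" "(s, q) \<in> D" "cc (s, q) \<in> M" by (cases z) auto
      then have "glued (s, unstereo q) \<in> B" using M(3) EPcc(1) by metis
      then show "z \<in> from_product -` B \<inter> topspace (top_of_set (base1 \<times> S2))"
        using *(1,2) by (simp add: from_product_def D_def mem_Times_iff)
    qed
    ultimately show "\<exists>T. openin (top_of_set (base1 \<times> S2)) T \<and> y \<in> T \<and> T \<subseteq> from_product -` B \<inter> topspace (top_of_set (base1 \<times> S2))"
      by blast
  qed
qed

lemma homeomorphic_maps_sphere_fam: "homeomorphic_maps (fam_top sphere_fam) (top_of_set (base1 \<times> S2)) to_product from_product"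
  unfolding homeomorphic_maps_def topspace_fam_top_sphere_fam
  using continuous_map_to_product continuous_map_from_product
  by (auto simp: points_sphere_fam to_product_glued from_product_def unstereo_stereo stereo_unstereo)

lemma fibre_sphere_fam: "s \<in> base1 \<Longrightarrow> fibre sphere_fam s = glued ` ({s} \<times> UNIV)"
  by (auto simp: fibre_def points_sphere_fam proj_sphere_fam)

lemma fibre_sphere_fam_homeomorphic:
  assumes s: "s \<in> base1"
  shows "subtopology (fam_top sphere_fam) (fibre sphere_fam s) homeomorphic_space top_of_set S2"
proof -
  have H: "homeomorphic_map (fam_top sphere_fam) (top_of_set (base1 \<times> S2)) to_product"
    using homeomorphic_maps_sphere_fam homeomorphic_maps_map by blast
  have "to_product ` (topspace (fam_top sphere_fam) \<inter> fibre sphere_fam s) = topspace (top_of_set (base1 \<times> S2)) \<inter> ({s} \<times> S2)"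
  proof -
    have "topspace (fam_top sphere_fam) \<inter> fibre sphere_fam s = glued ` ({s} \<times> UNIV)"
      using s by (auto simp: topspace_fam_top_sphere_fam fibre_sphere_fam points_sphere_fam)
    then have "to_product ` (topspace (fam_top sphere_fam) \<inter> fibre sphere_fam s) = {s} \<times> range stereo"
      using s by (auto simp: to_product_glued image_image image_iff)
    moreover have "range stereo = S2"
      using stereo_in_S2 stereo_unstereo by (metis image_subset_iff subsetI subset_antisym rangeI)
    ultimately show ?thesis using s by auto
  qed
  from homeomorphic_map_subtopologies[OF H this]
  have "subtopology (fam_top sphere_fam) (fibre sphere_fam s) homeomorphic_space subtopology (top_of_set (base1 \<times> S2)) ({s} \<times> S2)"
    by (rule homeomorphic_map_imp_homeomorphic_space)
  also have "subtopology (top_of_set (base1 \<times> S2)) ({s} \<times> S2) = prod_topology (subtopology (top_of_set {s}) {s}) (top_of_set S2)"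
  proof -
    have "(base1 \<times> S2) \<inter> ({s} \<times> S2) = {s} \<times> S2" using s by auto
    then show ?thesis by (simp add: subtopology_subtopology)
  qed
  also have "\<dots> homeomorphic_space top_of_set S2"
    using homeomorphic_space_prod_topology_sing2[of s "top_of_set {s}" "top_of_set S2"] homeomorphic_space_sym by fastforce
  finally show ?thesis .
qed

section \<open>Genus 0 by homology of the 2-sphere\<close>

lemma trivial_groups_isomorphic:
  assumes "trivial_group G" "trivial_group H"
  shows "G \<cong> H"
proof -
  have "(\<lambda>_. \<one>\<^bsub>H\<^esub>) \<in> iso G H"
    using assms monoid.l_one[of H "\<one>\<^bsub>H\<^esub>"] group.is_monoid[of H]
    by (auto simp: trivial_group_def iso_def hom_def bij_betw_def)
  then show ?thesis by (auto simp: is_iso_def)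
qed

text \<open>In degree 1 reduced and ordinary homology agree, and both vanish for the 2-sphere, while
  the free Abelian group on no generators is trivial as well.\<close>

lemma has_genus_0_S2:
  assumes "T homeomorphic_space top_of_set S2"
  shows "has_genus T 0"
proof -
  obtain f :: "(nat \<Rightarrow> real) \<Rightarrow> complex \<times> real" and g
    where "homeomorphic_maps (nsphere (3 - 1)) (top_of_set (S2 \<inter> span Basis)) f g"
  proof (rule homeomorphic_maps_nsphere_euclidean_sphere[of "Basis :: (complex \<times> real) set" 3])
    show "card (Basis :: (complex \<times> real) set) = 3"
      using DIM_prod[where 'a = complex and 'b = real] by simp
  qed (auto simp: independent_Basis intro: pairwise_mono orthogonal_Basis)
  then have "nsphere 2 homeomorphic_space top_of_set S2"
    by (auto simp: homeomorphic_space_def)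
  then have "T homeomorphic_space nsphere 2"
    using assms homeomorphic_space_sym homeomorphic_space_trans by blast
  then have "reduced_homology_group 1 T \<cong> reduced_homology_group 1 (nsphere 2)"
    by (rule homeomorphic_space_imp_isomorphic_reduced_homology_groups)
  moreover have "trivial_group (reduced_homology_group 1 (nsphere 2))"
    by (simp add: trivial_reduced_homology_group_nsphere)
  ultimately have "trivial_group (homology_group 1 T)"
    using isomorphic_group_triviality[of "reduced_homology_group 1 T" "reduced_homology_group 1 (nsphere 2)"]
    by (simp add: un_reduced_homology_group)
  moreover have "trivial_group (free_Abelian_group ({}::nat set))"
    by (simp add: trivial_group_def) (simp add: free_Abelian_group_def)
  ultimately show ?thesis
    unfolding has_genus_def using trivial_groups_isomorphic by simp
qed

section \<open>Families obtained by changing the marks\<close>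

lemma mark_update_simps:
  "charts (Y\<lparr>mark := \<mu>\<rparr>) = charts Y" "proj (Y\<lparr>mark := \<mu>\<rparr>) = proj Y" "bdim (Y\<lparr>mark := \<mu>\<rparr>) = bdim Y"
  "points (Y\<lparr>mark := \<mu>\<rparr>) = points Y" "base (Y\<lparr>mark := \<mu>\<rparr>) = base Y"
  by simp_all

lemma coord_mark_update [simp]: "coord (Y\<lparr>mark := \<mu>\<rparr>) = coord Y"
  by (intro ext) (simp only: coord_def mark_update_simps)

lemma fam_top_mark_update [simp]: "fam_top (Y\<lparr>mark := \<mu>\<rparr>) = fam_top Y"
  by (simp only: fam_top_def mark_update_simps coord_mark_update)

lemma fibre_mark_update [simp]: "fibre (Y\<lparr>mark := \<mu>\<rparr>) = fibre Y"
  by (intro ext) (simp only: fibre_def mark_update_simps)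

lemma holomorphic_atlas_mark_update [simp]: "holomorphic_atlas (Y\<lparr>mark := \<mu>\<rparr>) = holomorphic_atlas Y"
  by (simp only: holomorphic_atlas_def mark_update_simps coord_mark_update)

lemma chart_point_0_sphere_param: "chart_point 0 r (a, t) = glued (vec1 t, sphere_param r a)"
  by (simp add: chart_point_def param_val_def)

text \<open>Used in two ways: with \<open>\<tau>\<close> the identity it follows a mark over the
  base, and with \<open>\<tau>\<close> constant it changes coordinates inside one fibre.\<close>

lemma chart_point_transition_along:
  assumes p: "(R t, \<tau> t) \<in> param_dom k r" and N': "open N'" "N' \<subseteq> param_dom k' r'" "(a', \<tau> t) \<in> N'"
    and eq: "chart_point k r (R t, \<tau> t) = chart_point k' r' (a', \<tau> t)"
    and R: "R field_differentiable at t" and \<tau>: "\<tau> field_differentiable at t"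
  obtains T where "T field_differentiable at t" "T t = a'"
    "\<forall>\<^sub>F s in nhds t. (T s, \<tau> s) \<in> N' \<and> chart_point k r (R s, \<tau> s) = chart_point k' r' (T s, \<tau> s)"
proof -
  obtain T where T: "hol2 T (R t, \<tau> t)" "T (R t, \<tau> t) = fst (a', \<tau> t)"
    "\<forall>\<^sub>F q in nhds (R t, \<tau> t). q \<in> param_dom k r \<and> (T q, snd q) \<in> N' \<and> chart_point k r q = chart_point k' r' (T q, snd q)"
    using chart_point_transition[OF p N' eq] by blast
  have "((\<lambda>s. (R s, \<tau> s)) \<longlongrightarrow> (R t, \<tau> t)) (nhds t)"
    using R \<tau> by (intro tendsto_Pair field_differentiable_tendsto)
  from filterlim_iff[THEN iffD1, OF this, rule_format, OF T(3)]
  have ev: "\<forall>\<^sub>F s in nhds t. (T (R s, \<tau> s), \<tau> s) \<in> N' \<and> chart_point k r (R s, \<tau> s) = chart_point k' r' (T (R s, \<tau> s), \<tau> s)"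
    by eventually_elim auto
  show thesis
    by (rule that[of "\<lambda>s. T (R s, \<tau> s)"]) (use hol2_along[OF T(1) R \<tau>] T(2) ev in auto)
qed

text \<open>The mark is prescribed on the first sphere by a differentiable \<open>R\<close> in
  either sphere chart, so that a mark at infinity is allowed; transitions then make it holomorphic
  in every chart.\<close>

lemma holomorphic_section_sphere_fam:
  assumes \<sigma>: "\<And>s. s \<in> base1 \<Longrightarrow> \<sigma> s = glued (s, m (s 0))"
    and m: "\<And>t. 0 < norm t \<Longrightarrow> norm t < 1 \<Longrightarrow>
      \<exists>r R. R field_differentiable at t \<and> (\<forall>\<^sub>F \<tau> in nhds t. m \<tau> = sphere_param r (R \<tau>))"
  shows "holomorphic_section (sphere_fam\<lparr>mark := \<mu>\<rparr>) \<sigma>"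
proof -
  have "openin (top_of_set (Cn (Suc 0))) {s \<in> base1. \<sigma> s \<in> V} \<and>
        holo (Suc 0) {s \<in> base1. \<sigma> s \<in> V} (\<lambda>s. \<xi> (\<sigma> s))" if c: "(V, \<xi>) \<in> charts sphere_fam" for V \<xi>
  proof -
    obtain k' r' N' where n': "normal_chart k' r' N' V \<xi>" using charts_sphere_fam_normal_chart[OF c] .
    have N': "open N'" "N' \<subseteq> param_dom k' r'" "V = chart_point k' r' ` N'" using n' by (auto simp: normal_chart_def)
    define D where "D = {t::complex. 0 < norm t \<and> norm t < 1}"
    have D: "open D" unfolding D_def by (intro open_Collect_conj open_Collect_less continuous_intros)
    define M where "M = {t \<in> D. glued (vec1 t, m t) \<in> V}"
    have \<sigma>M: "\<sigma> (vec1 t) = glued (vec1 t, m t)" if "t \<in> D" for t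
      using \<sigma>[of "vec1 t"] that by (simp add: D_def vec1_base1_iff)
    have eq: "{s \<in> base1. \<sigma> s \<in> V} = vec1 ` M"
      using \<sigma>M by (auto simp: M_def punctured_polydisc_1 D_def)
    have *: "(\<forall>\<^sub>F \<tau> in nhds t. \<tau> \<in> M) \<and> (\<lambda>\<tau>. \<xi> (\<sigma> (vec1 \<tau>))) field_differentiable at t" if t: "t \<in> M" for t
    proof -
      have tD: "t \<in> D" using t by (simp add: M_def)
      obtain r R where R: "R field_differentiable at t" "\<forall>\<^sub>F \<tau> in nhds t. m \<tau> = sphere_param r (R \<tau>)"
        using m[of t] tD by (auto simp: D_def)
      have mt: "m t = sphere_param r (R t)" using R(2) by (rule eventually_nhds_x_imp_x)
      have k0: "(R \<tau>, \<tau>) \<in> param_dom 0 r" if "\<tau> \<in> D" for \<tau> using that by (simp add: param_dom_def D_def)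
      obtain p' where p': "p' \<in> N'" "glued (vec1 t, m t) = chart_point k' r' p'" using t N'(3) by (auto simp: M_def)
      obtain a' t' where at: "p' = (a', t')" by (cases p')
      have eqE: "chart_point 0 r (R t, t) = chart_point k' r' (a', t')" using p' by (simp add: at chart_point_0_sphere_param mt)
      have "t' = t" using chart_point_eq_iff[OF k0[OF tD], of a' t' k' r'] eqE p' N' at by auto
      then have a': "(a', t) \<in> N'" "chart_point 0 r (R t, t) = chart_point k' r' (a', t)" using p'(1) eqE at by simp_all
      obtain T where T: "T field_differentiable at t"
        "\<forall>\<^sub>F s in nhds t. (T s, s) \<in> N' \<and> chart_point 0 r (R s, s) = chart_point k' r' (T s, s)"
        using chart_point_transition_along[of R t "\<lambda>s. s", OF k0[OF tD] N'(1,2) a' R(1) field_differentiable_ident] by blast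
      have ev: "\<forall>\<^sub>F \<tau> in nhds t. \<tau> \<in> D \<and> (T \<tau>, \<tau>) \<in> N' \<and> glued (vec1 \<tau>, m \<tau>) = chart_point k' r' (T \<tau>, \<tau>)"
        using T(2) R(2) eventually_nhds_in_open[OF D tD] by eventually_elim (auto simp: chart_point_0_sphere_param)
      have evT: "\<forall>\<^sub>F \<tau> in nhds t. T \<tau> = \<xi> (\<sigma> (vec1 \<tau>))"
        using ev by eventually_elim (use n' \<sigma>M in \<open>auto simp: normal_chart_def\<close>)
      have evM: "\<forall>\<^sub>F \<tau> in nhds t. \<tau> \<in> M"
        using ev by eventually_elim (auto simp: M_def N'(3))
      show ?thesis by (intro conjI evM field_differentiable_cong_ev[OF T(1) evT])
    qed
    have "open M" by (rule eventually_nhds_openI) (use * in blast)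
    then show ?thesis unfolding eq using * by (auto intro!: holo_1 simp: openin_Cn_1_iff)
  qed
  moreover have "\<sigma> s \<in> fibre sphere_fam s" if "s \<in> base1" for s
    using that by (simp add: fibre_sphere_fam \<sigma>)
  ultimately show ?thesis by (auto simp: holomorphic_section_def)
qed

text \<open>Only the marks vary here, so this covers the plumbing family and the test family alike.
  Properness is transported from the projection of \<open>base1 \<times> S2\<close>, which is closed
  with compact fibres because the sphere is compact.\<close>

lemma family_sphere_fam:
  assumes \<mu>: "\<And>s j. s \<in> base1 \<Longrightarrow> j < 4 \<Longrightarrow> \<mu> j s = glued (s, m j (s 0))"
    and m: "\<And>t j. 0 < norm t \<Longrightarrow> norm t < 1 \<Longrightarrow> j < 4 \<Longrightarrow>
      \<exists>r R. R field_differentiable at t \<and> (\<forall>\<^sub>F \<tau> in nhds t. m j \<tau> = sphere_param r (R \<tau>))"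
    and inj: "\<And>t. 0 < norm t \<Longrightarrow> norm t < 1 \<Longrightarrow> inj_on (\<lambda>j. m j t) {..<4}"
  shows "family 0 4 (sphere_fam\<lparr>mark := \<mu>\<rparr>)"
proof -
  let ?P = "top_of_set (base1 \<times> S2)"
  have H: "homeomorphic_map (fam_top sphere_fam) ?P to_product"
    using homeomorphic_maps_sphere_fam homeomorphic_maps_map by blast
  have hs: "fam_top sphere_fam homeomorphic_space ?P"
    using H homeomorphic_map_imp_homeomorphic_space by blast
  have "openin (top_of_set (Cn (Suc 0))) base1"
    unfolding openin_Cn_1_iff punctured_polydisc_1
    by (intro exI[of _ "{t. 0 < norm t \<and> norm t < 1}"] conjI refl open_Collect_conj open_Collect_less continuous_intros)
  moreover have "proj sphere_fam ` points sphere_fam \<subseteq> base1"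
    by (auto simp: points_sphere_fam proj_sphere_fam)
  moreover have "Hausdorff_space (fam_top sphere_fam)"
    using homeomorphic_Hausdorff_space[OF hs] by (simp add: Hausdorff_space_subtopology)
  moreover have "proper_map (fam_top sphere_fam) (top_of_set base1) (proj sphere_fam)"
  proof -
    have P: "?P = prod_topology (top_of_set base1) (top_of_set S2)" by simp
    have "closed_map ?P (top_of_set base1) fst"
      unfolding P by (rule Abstract_Topological_Spaces.closed_map_fst) (simp add: compact_space_subtopology)
    moreover have "compactin ?P {x \<in> topspace ?P. fst x = s}" if "s \<in> base1" for s
    proof -
      have "{x \<in> topspace ?P. fst x = s} = {s} \<times> S2" using that by auto
      moreover have "compactin ?P ({s} \<times> S2)"
        unfolding P compactin_Times using that by (simp add: compactin_subtopology)
      ultimately show ?thesis by simp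
    qed
    ultimately have "proper_map ?P (top_of_set base1) fst"
      by (simp add: proper_map_def)
    from proper_map_compose[OF homeomorphic_imp_proper_map[OF H] this]
    have pm: "proper_map (fam_top sphere_fam) (top_of_set base1) (fst \<circ> to_product)" .
    have eq: "(fst \<circ> to_product) c = proj sphere_fam c" if "c \<in> topspace (fam_top sphere_fam)" for c
      using that by (auto simp: topspace_fam_top_sphere_fam points_sphere_fam proj_sphere_fam to_product_glued)
    have "closed_map (fam_top sphere_fam) (top_of_set base1) (proj sphere_fam)"
      using closed_map_eq[OF proper_imp_closed_map[OF pm] eq] .
    moreover have "{c \<in> topspace (fam_top sphere_fam). (fst \<circ> to_product) c = s} = {c \<in> topspace (fam_top sphere_fam). proj sphere_fam c = s}" for s
      by (rule Collect_cong) (use eq in auto)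
    ultimately show ?thesis using pm by (simp add: proper_map_def)
  qed
  moreover have "fibre sphere_fam s \<noteq> {} \<and> connected_space (subtopology (fam_top sphere_fam) (fibre sphere_fam s)) \<and>
      has_genus (subtopology (fam_top sphere_fam) (fibre sphere_fam s)) 0" if s: "s \<in> base1" for s
  proof -
    have "connected S2" by (rule connected_sphere) simp
    then have "connected_space (subtopology (fam_top sphere_fam) (fibre sphere_fam s))"
      using homeomorphic_connected_space[OF fibre_sphere_fam_homeomorphic[OF s]]
      by (simp add: connected_space_subtopology)
    then show ?thesis using has_genus_0_S2[OF fibre_sphere_fam_homeomorphic[OF s]] s by (simp add: fibre_sphere_fam)
  qed
  moreover have "holomorphic_section (sphere_fam\<lparr>mark := \<mu>\<rparr>) (\<mu> i)" if "i < 4" for i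
    by (rule holomorphic_section_sphere_fam[of _ "m i"]) (use \<mu> m that in auto)
  moreover have "inj_on (\<lambda>i. \<mu> i s) {..<4}" if "s \<in> base1" for s
  proof (rule inj_onI)
    fix i j assume ij: "i \<in> {..<4::nat}" "j \<in> {..<4}" and eq: "\<mu> i s = \<mu> j s"
    then have "m i (s 0) = m j (s 0)" using that \<mu> by (simp add: glued_eq_iff)
    then show "i = j" using inj[of "s 0"] ij base1_nz[OF that] by (auto simp: inj_on_def)
  qed
  ultimately show ?thesis
    unfolding family_def by (simp add: holomorphic_atlas_sphere_fam)
qed

section \<open>Failure of etaleness\<close>

lemma holo_prod_field_differentiable:
  "holo_prod k W F \<Longrightarrow> (a, s) \<in> W \<Longrightarrow> (\<lambda>u. F (u, s)) field_differentiable at a"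
  unfolding holo_prod_def by blast

text \<open>Both families share total space and charts, so holomorphy of the identity is holomorphy
  of a chart transition, restricted to the slice of constant parameter.\<close>

lemma fibre_iso_id:
  assumes s: "s \<in> base1" and marks: "\<And>i. i < n \<Longrightarrow> \<mu> i s = mark sphere_fam i s"
  shows "fibre_iso n (sphere_fam\<lparr>mark := \<mu>\<rparr>) s sphere_fam s id"
proof -
  obtain t0 where t0: "s = vec1 t0" using s by (auto simp: punctured_polydisc_1)
  have "open (\<zeta> ` A) \<and> (\<lambda>u. \<xi> (inv_into A \<zeta> u)) holomorphic_on \<zeta> ` A"
    if c: "(U, \<zeta>) \<in> charts sphere_fam" "(V, \<xi>) \<in> charts sphere_fam" and A: "A = {y \<in> fibre sphere_fam s \<inter> U. y \<in> V}" for U \<zeta> V \<xi> A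
  proof -
    obtain k r N where n: "normal_chart k r N U \<zeta>" using charts_sphere_fam_normal_chart[OF c(1)] .
    have N: "N \<subseteq> param_dom k r" "U = chart_point k r ` N" "\<And>p. p \<in> N \<Longrightarrow> \<zeta> (chart_point k r p) = fst p" using n by (auto simp: normal_chart_def)
    define M where "M = {p \<in> N. chart_point k r p \<in> V}"
    have MN: "M \<subseteq> N" by (auto simp: M_def)
    have UV: "U \<inter> V = chart_point k r ` M" using N by (auto simp: M_def)
    have "rel_open (Suc 0) (coord sphere_fam \<zeta> ` (U \<inter> V))"
      and hp: "holo_prod (Suc 0) (coord sphere_fam \<zeta> ` (U \<inter> V)) (\<lambda>x. \<xi> (inv_into U (coord sphere_fam \<zeta>) x))"
      using holomorphic_atlas_sphere_fam c unfolding holomorphic_atlas_def sphere_fam_simps by blast+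
    then have "open M" by (simp add: UV coord_image_chart_point[OF n MN] rel_open_1_lift)
    define M0 where "M0 = {a. (a, t0) \<in> M}"
    have "open ((\<lambda>a. (a, t0)) -` M)"
      by (intro open_vimage \<open>open M\<close> continuous_intros)
    then have M0: "open M0" by (simp add: M0_def vimage_def)
    have EPf: "chart_point k r (a, t) \<in> fibre sphere_fam s \<longleftrightarrow> t = t0" if "(a, t) \<in> N" for a t
    proof -
      have "vec1 t \<in> base1" using param_dom_base1 N(1) that by blast
      then show ?thesis by (auto simp: chart_point_def t0 fibre_sphere_fam[OF s[unfolded t0]] glued_eq_iff s[unfolded t0] image_iff)
    qed
    have A': "A = (\<lambda>a. chart_point k r (a, t0)) ` M0"
      using EPf UV MN unfolding A M0_def by (auto simp: image_iff M_def N(2)) 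
    have \<zeta>a: "\<zeta> (chart_point k r (a, t0)) = a" if "a \<in> M0" for a
      using that N(3)[of "(a, t0)"] MN by (auto simp: M0_def)
    have img: "\<zeta> ` A = M0" unfolding A' image_image using \<zeta>a by simp
    have inv: "inv_into A \<zeta> a = chart_point k r (a, t0)" if "a \<in> M0" for a
    proof (rule inv_into_f_eq)
      show "inj_on \<zeta> A" unfolding A' using \<zeta>a by (intro inj_onI) auto
    qed (use that \<zeta>a A' in auto)
    have "(\<lambda>u. \<xi> (inv_into A \<zeta> u)) field_differentiable at a" if a: "a \<in> M0" for a
    proof -
      have "(a, s) \<in> coord sphere_fam \<zeta> ` (U \<inter> V)"
        unfolding UV coord_image_chart_point[OF n MN] using a by (force simp: M0_def lift_def t0)
      from holo_prod_field_differentiable[OF hp this]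
      have "(\<lambda>u. \<xi> (inv_into U (coord sphere_fam \<zeta>) (u, s))) field_differentiable at a" .
      moreover have "\<forall>\<^sub>F u in nhds a. \<xi> (inv_into U (coord sphere_fam \<zeta>) (u, s)) = \<xi> (inv_into A \<zeta> u)"
        using eventually_nhds_in_open[OF M0 a]
      proof eventually_elim
        case (elim u)
        then have "(u, t0) \<in> N" using MN by (auto simp: M0_def)
        then show ?case using inv_coord_chart_point[OF n, of "(u, t0)"] inv[OF elim] by (simp add: lift_def t0)
      qed
      ultimately show ?thesis by (rule field_differentiable_cong_ev)
    qed
    then show ?thesis
      unfolding img using M0 by (simp add: holomorphic_on_open field_differentiable_def)
  qed
  then show ?thesis
    unfolding fibre_iso_def using marks by (auto simp: Let_def)
qed

text \<open>On a fibre the arrow is a bijection of spheres that fixes infinity because of mark 0,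
  hence is an injective entire function on the plane and so affine. Mark 1 makes it fix -8/7, which
  leaves a single scale factor \<open>c\<close>.\<close>

lemma family_arrow_affine:
  assumes arrow: "family_arrow 4 (sphere_fam\<lparr>mark := \<mu>\<rparr>) S sphere_fam f \<Phi>"
    and s: "vec1 \<tau> \<in> S" "vec1 \<tau> \<in> base1"
    and \<mu>: "\<And>j. j < 4 \<Longrightarrow> \<mu> j (vec1 \<tau>) = glued (vec1 \<tau>, [None, Some (- (8/7)), Some p2, Some p3] ! j)"
  obtains c where "c \<noteq> 0" "koebe (- f (vec1 \<tau>) 0) = - (8/7) + c * (p2 + 8/7)"
    "koebe (f (vec1 \<tau>) 0) = - (8/7) + c * (p3 + 8/7)"
proof -
  define \<sigma> where "\<sigma> = f (vec1 \<tau>) 0"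
  have fb: "f (vec1 \<tau>) \<in> base1" using arrow s by (auto simp: family_arrow_def)
  have f\<sigma>: "f (vec1 \<tau>) = vec1 \<sigma>" using base1_vec1[OF fb] by (simp add: \<sigma>_def)
  have b\<sigma>: "vec1 \<sigma> \<in> base1" using fb f\<sigma> by simp
  have bij: "bij_betw \<Phi> (glued ` ({vec1 \<tau>} \<times> UNIV)) (glued ` ({vec1 \<sigma>} \<times> UNIV))"
    using arrow s by (auto simp: family_arrow_def fibre_sphere_fam f\<sigma> b\<sigma>)
  \<comment> \<open>The map \<open>\<Phi>\<close> on the fibre over \<open>\<tau>\<close>, read as a
    self-map of the first sphere.\<close>
  define hs where "hs = (\<lambda>x. snd (inv_into (base1 \<times> UNIV) glued (\<Phi> (glued (vec1 \<tau>, x)))))"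
  have hs: "\<Phi> (glued (vec1 \<tau>, x)) = glued (vec1 \<sigma>, hs x)" for x
  proof -
    have "\<Phi> (glued (vec1 \<tau>, x)) \<in> glued ` ({vec1 \<sigma>} \<times> UNIV)" by (rule bij_betw_apply[OF bij]) simp
    then obtain y where y: "\<Phi> (glued (vec1 \<tau>, x)) = glued (vec1 \<sigma>, y)" by auto
    then show ?thesis by (simp add: hs_def inv_into_f_f[OF inj_on_glued] b\<sigma>)
  qed
  have inj: "hs x = hs y \<Longrightarrow> x = y" for x y
  proof -
    assume "hs x = hs y"
    then have "\<Phi> (glued (vec1 \<tau>, x)) = \<Phi> (glued (vec1 \<tau>, y))" by (simp add: hs)
    then have "glued (vec1 \<tau>, x) = glued (vec1 \<tau>, y)"
      using bij by (auto simp: bij_betw_def dest: inj_onD)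
    then show "x = y" using s by (simp add: glued_eq_iff)
  qed
  have hm: "hs ([None, Some (- (8/7)), Some p2, Some p3] ! j) =
      [None, Some (- (8/7)), Some (koebe (- \<sigma>)), Some (koebe \<sigma>)] ! j" if "j < 4" for j
  proof -
    have "\<Phi> (\<mu> j (vec1 \<tau>)) = mark sphere_fam j (vec1 \<sigma>)"
      using arrow s that by (auto simp: family_arrow_def f\<sigma>)
    then show ?thesis using \<mu>[OF that] mark_sphere_fam[OF b\<sigma> that] b\<sigma> by (simp add: hs glued_eq_iff)
  qed
  have h0: "hs None = None" using hm[of 0] by simp
  define h where "h = (\<lambda>x. the (hs (Some x)))"
  have h: "hs (Some x) = Some (h x)" for x
  proof -
    have "hs (Some x) \<noteq> None" using inj[of "Some x" None] h0 by auto
    then show ?thesis by (auto simp: h_def)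
  qed
  have "inj h" using inj h by (metis injI option.inject)
  \<comment> \<open>Near \<open>x\<close> the map is a composite of three: \<open>T1\<close> from
    the plane into a chart of the source, \<open>G\<close> for \<open>\<Phi>\<close> between charts,
    and \<open>T2\<close> from the target chart back to the plane.\<close>
  moreover have "h field_differentiable at x" for x
  proof -
    obtain U \<zeta> where U: "(U, \<zeta>) \<in> charts sphere_fam" "glued (vec1 \<tau>, Some x) \<in> U" using charts_sphere_fam_cover[OF s(2)] by metis
    obtain V \<xi> where V: "(V, \<xi>) \<in> charts sphere_fam" "glued (vec1 \<sigma>, Some (h x)) \<in> V" using charts_sphere_fam_cover[OF b\<sigma>] by metis
    obtain k r N where n: "normal_chart k r N U \<zeta>" using charts_sphere_fam_normal_chart[OF U(1)] .
    obtain k' r' N' where n': "normal_chart k' r' N' V \<xi>" using charts_sphere_fam_normal_chart[OF V(1)] .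
    have N: "N \<subseteq> param_dom k r" "U = chart_point k r ` N" using n by (auto simp: normal_chart_def)
    have N': "N' \<subseteq> param_dom k' r'" "V = chart_point k' r' ` N'" "\<And>p. p \<in> N' \<Longrightarrow> \<xi> (chart_point k' r' p) = fst p" using n' by (auto simp: normal_chart_def)
    define M where "M = {p \<in> N. vec1 (snd p) \<in> S \<and> \<Phi> (chart_point k r p) \<in> V}"
    have MN: "M \<subseteq> N" by (auto simp: M_def)
    have pr: "proj sphere_fam (chart_point k r p) = vec1 (snd p)" if "p \<in> N" for p
      using proj_sphere_fam param_dom_base1 N(1) that by (cases p) (auto simp: chart_point_def)
    have A: "{y \<in> U. proj sphere_fam y \<in> S \<and> \<Phi> y \<in> V} = chart_point k r ` M"
      using pr by (auto simp: M_def N(2))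
    have "rel_open (Suc 0) (coord sphere_fam \<zeta> ` {y \<in> U. proj sphere_fam y \<in> S \<and> \<Phi> y \<in> V}) \<and>
        holo_prod (Suc 0) (coord sphere_fam \<zeta> ` {y \<in> U. proj sphere_fam y \<in> S \<and> \<Phi> y \<in> V}) (\<lambda>x. \<xi> (\<Phi> (inv_into U (coord sphere_fam \<zeta>) x)))"
      using arrow U(1) V(1) unfolding family_arrow_def Let_def mark_update_simps coord_mark_update sphere_fam_simps by blast
    then have oM: "open M" and hp: "holo_prod (Suc 0) (lift ` M) (\<lambda>x. \<xi> (\<Phi> (inv_into U (coord sphere_fam \<zeta>) x)))"
      unfolding A coord_image_chart_point[OF n MN] rel_open_1_lift by blast+
    obtain a t where at: "(a, t) \<in> N" "glued (vec1 \<tau>, Some x) = chart_point k r (a, t)" using U(2) N(2) by auto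
    have x0: "(y, \<tau>) \<in> param_dom 0 False" for y using s(2) by (simp add: param_dom_def vec1_base1_iff)
    have y0: "(y, \<sigma>) \<in> param_dom 0 False" for y using b\<sigma> by (simp add: param_dom_def vec1_base1_iff)
    have EP0: "chart_point 0 False (y, u) = glued (vec1 u, Some y)" for y u by (simp add: chart_point_0_sphere_param sphere_param_def inv_if_def)
    have "t = \<tau>" using chart_point_eq_iff[OF x0[of x], of a t k r] at N(1) EP0 by auto
    note at = at[unfolded this]
    have aM: "(a, \<tau>) \<in> M" using at s(1) V(2) by (simp add: M_def hs h flip: at(2))
    have eq0: "chart_point 0 False (x, \<tau>) = chart_point k r (a, \<tau>)" by (simp add: EP0 at(2))
    obtain T1 where T1: "T1 field_differentiable at x" "T1 x = a"
      "\<forall>\<^sub>F y in nhds x. (T1 y, \<tau>) \<in> M \<and> chart_point 0 False (y, \<tau>) = chart_point k r (T1 y, \<tau>)"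
      using chart_point_transition_along[of "\<lambda>y. y" x "\<lambda>_. \<tau>", OF x0 oM order_trans[OF MN N(1)] aM eq0 field_differentiable_ident field_differentiable_const] by blast
    define G where "G = (\<lambda>u. \<xi> (\<Phi> (inv_into U (coord sphere_fam \<zeta>) (lift (u, \<tau>)))))"
    have "(a, vec1 \<tau>) \<in> lift ` M" using aM by (force simp: lift_def)
    from holo_prod_field_differentiable[OF hp this]
    have G: "G field_differentiable at a" by (simp add: G_def lift_def)
    have Ge: "\<Phi> (chart_point k r (u, \<tau>)) = chart_point k' r' (G u, \<sigma>) \<and> (G u, \<sigma>) \<in> N'" if u: "(u, \<tau>) \<in> M" for u
    proof -
      have uN: "(u, \<tau>) \<in> N" using u MN by blast
      have "\<Phi> (chart_point k r (u, \<tau>)) \<in> V" using u by (simp add: M_def)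
      then obtain g \<rho> where g: "(g, \<rho>) \<in> N'" "\<Phi> (chart_point k r (u, \<tau>)) = chart_point k' r' (g, \<rho>)" using N'(2) by auto
      have "G u = g" unfolding G_def inv_coord_chart_point[OF n uN] g(2) using N'(3)[OF g(1)] by simp
      moreover have "glued (vec1 \<sigma>, hs (param_val k r (u, \<tau>))) = glued (vec1 \<rho>, param_val k' r' (g, \<rho>))"
        using g(2) by (simp add: chart_point_def hs)
      then have "\<rho> = \<sigma>" using b\<sigma> param_dom_base1 g(1) N'(1) by (metis glued_eq_iff subsetD vec1_eq_iff)
      ultimately show ?thesis using g by simp
    qed
    have G1: "(\<lambda>y. G (T1 y)) field_differentiable at x"
      using field_differentiable_compose[OF T1(1), of G] G T1(2) by (simp add: o_def)
    have eqx: "chart_point k' r' (G (T1 x), \<sigma>) = chart_point 0 False (h x, \<sigma>)"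
      using Ge[OF aM] hs[of "Some x"] by (simp add: T1(2) EP0 h at(2))
    have dom': "(G (T1 x), \<sigma>) \<in> param_dom k' r'" using Ge[OF aM] N'(1) by (auto simp: T1(2))
    obtain T2 where T2: "T2 field_differentiable at x" "T2 x = h x"
      "\<forall>\<^sub>F y in nhds x. (T2 y, \<sigma>) \<in> param_dom 0 False \<and> chart_point k' r' (G (T1 y), \<sigma>) = chart_point 0 False (T2 y, \<sigma>)"
      using chart_point_transition_along[of "\<lambda>y. G (T1 y)" x "\<lambda>_. \<sigma>", OF dom' open_param_dom order_refl y0 eqx G1 field_differentiable_const] by blast
    have "\<forall>\<^sub>F y in nhds x. T2 y = h y"
      using T1(3) T2(3)
    proof eventually_elim
      case (elim y)
      have "glued (vec1 \<sigma>, Some (h y)) = \<Phi> (chart_point 0 False (y, \<tau>))" by (simp add: EP0 hs h)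
      also have "\<dots> = glued (vec1 \<sigma>, Some (T2 y))" using elim Ge[of "T1 y"] by (simp add: EP0)
      finally show ?case using b\<sigma> by (simp add: glued_eq_iff)
    qed
    then show ?thesis using field_differentiable_cong_ev[OF T2(1)] by blast
  qed
  then have "h holomorphic_on UNIV" by (simp add: holomorphic_on_open field_differentiable_def)
  ultimately obtain c where c: "c \<noteq> 0" "\<And>x. h x = h 0 + c * x" using injective_entire_affine by metis
  have "h (- (8/7)) = - (8/7)" "h p2 = koebe (- \<sigma>)" "h p3 = koebe \<sigma>"
    using hm[of 1] hm[of 2] hm[of 3] h by (simp_all add: numeral_3_eq_3)
  \<comment> \<open>Recentring the affine map at its fixed point -8/7.\<close>
  moreover have "h x = h (- (8/7)) + c * (x + 8/7)" for x
    using c(2)[of x] c(2)[of "- (8/7)"] by (simp add: algebra_simps)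
  ultimately show thesis using that[OF c(1)] unfolding \<sigma>_def by metis
qed

section \<open>The critical point of the modulus\<close>

definition t0 :: complex where "t0 = \<i> / 2"

lemma koebe_t0: "koebe t0 = Complex (- 8/25) (6/25)" "koebe (- t0) = Complex (- 8/25) (- 6/25)"
  by (simp_all add: koebe_def t0_def complex_eq_iff Re_divide Im_divide power2_eq_square)

lemma norm_t0: "norm t0 = 1/2"
  by (simp add: t0_def norm_divide)

text \<open>An affine map fixing -8/7 multiplies numerator and denominator by the same factor, so
  the ratio cannot see the unknown \<open>c\<close> of an arrow.\<close>

definition modulus :: "complex \<Rightarrow> complex" where
  "modulus t = (koebe t + 8/7) / (koebe (- t) + 8/7)"

lemma modulus_critical: "(modulus has_field_derivative 0) (at t0)"
proof -
  have n: "norm t0 < 1" "norm (- t0) < 1" by (simp_all add: norm_t0)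
  have nz: "koebe (- t0) + 8/7 \<noteq> 0" using koebe_neq_mark[OF n(2)] by (simp add: eq_neg_iff_add_eq_0)
  have d1: "((\<lambda>t. koebe t + 8/7) has_field_derivative (1 + t0) / (1 - t0) ^ 3) (at t0)"
    using DERIV_add[OF koebe_DERIV[OF n(1)] DERIV_const[of "8/7"]] by simp
  have "((\<lambda>t. koebe (- t)) has_field_derivative (1 + - t0) / (1 - - t0) ^ 3 * - 1) (at t0)"
    by (rule DERIV_chain2[where f = koebe and g = uminus, OF koebe_DERIV[OF n(2)]]) (auto intro!: derivative_eq_intros)
  from DERIV_add[OF this DERIV_const[of "8/7"]]
  have d2: "((\<lambda>t. koebe (- t) + 8/7) has_field_derivative - ((1 - t0) / (1 + t0) ^ 3)) (at t0)"
    by simp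
  \<comment> \<open>The numerator of the quotient rule; -8/7 is the real value of b that makes it
    vanish at \<open>t0\<close>.\<close>
  have "(1 + t0) / (1 - t0) ^ 3 * (koebe (- t0) + 8/7) - (koebe t0 + 8/7) * - ((1 - t0) / (1 + t0) ^ 3) = 0"
    unfolding koebe_t0
    by (simp add: t0_def complex_eq_iff Re_divide Im_divide power3_eq_cube)
  then show ?thesis
    using DERIV_divide[OF d1 d2 nz] by (simp add: modulus_def[abs_def])
qed

lemma marks_holomorphic:
  assumes "g field_differentiable at t"
  shows "\<exists>r R. R field_differentiable at t \<and> (\<forall>\<^sub>F \<tau> in nhds t. Some (g \<tau>) = sphere_param r (R \<tau>))"
  using assms by (intro exI[of _ False] exI[of _ g]) (simp add: sphere_param_def inv_if_def)

lemma less_4_cases: "j < (4::nat) \<Longrightarrow> j = 0 \<or> j = 1 \<or> j = 2 \<or> j = 3"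
  by auto

lemma family_sphere_fam_finite_marks:
  assumes \<mu>: "\<And>s j. s \<in> base1 \<Longrightarrow> j < 4 \<Longrightarrow> \<mu> j s = glued (s, [None, Some (g1 (s 0)), Some (g2 (s 0)), Some (g3 (s 0))] ! j)"
    and g: "\<And>t. 0 < norm t \<Longrightarrow> norm t < 1 \<Longrightarrow> g1 field_differentiable at t \<and> g2 field_differentiable at t \<and> g3 field_differentiable at t"
    and ne: "\<And>t. 0 < norm t \<Longrightarrow> norm t < 1 \<Longrightarrow> g1 t \<noteq> g2 t \<and> g1 t \<noteq> g3 t \<and> g2 t \<noteq> g3 t"
  shows "family 0 4 (sphere_fam\<lparr>mark := \<mu>\<rparr>)"
proof (rule family_sphere_fam[OF \<mu>])
  fix t :: complex assume t: "0 < norm t" "norm t < 1"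
  \<comment> \<open>The mark at infinity is the constant 0 in the chart at infinity.\<close>
  have "\<exists>r R. R field_differentiable at t \<and> (\<forall>\<^sub>F \<tau> in nhds t. None = sphere_param r (R \<tau>))"
    by (intro exI[of _ True] exI[of _ "\<lambda>_. 0"]) (simp add: sphere_param_def)
  then show "\<exists>r R. R field_differentiable at t \<and> (\<forall>\<^sub>F \<tau> in nhds t. [None, Some (g1 \<tau>), Some (g2 \<tau>), Some (g3 \<tau>)] ! j = sphere_param r (R \<tau>))"
    if "j < 4" for j
    using less_4_cases[OF that] g[OF t] marks_holomorphic[of g1 t] marks_holomorphic[of g2 t] marks_holomorphic[of g3 t]
    by (elim disjE) (simp_all add: numeral_3_eq_3)
  show "inj_on (\<lambda>j. [None, Some (g1 t), Some (g2 t), Some (g3 t)] ! j) {..<4}"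
    using ne[OF t] by (intro inj_on_nth) auto
qed

lemma koebe_uminus_field_differentiable: "norm t < 1 \<Longrightarrow> (\<lambda>t. koebe (- t)) field_differentiable at t"
  using field_differentiable_compose[of uminus t koebe] koebe_field_differentiable[of "- t"]
  by (simp add: o_def field_differentiable_minus field_differentiable_ident)

lemma family_plumbing: "family 0 4 sphere_fam"
proof -
  have "family 0 4 (sphere_fam\<lparr>mark := mark sphere_fam\<rparr>)"
  proof (rule family_sphere_fam_finite_marks[of _ "\<lambda>_. - (8/7)" "\<lambda>t. koebe (- t)" koebe])
    fix t :: complex assume t: "0 < norm t" "norm t < 1"
    show "- (8/7) \<noteq> koebe (- t) \<and> - (8/7) \<noteq> koebe t \<and> koebe (- t) \<noteq> koebe t"
      using koebe_neq_mark[of t] koebe_neq_mark[of "- t"] t by (auto simp: koebe_eq_iff)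
  qed (use mark_sphere_fam in \<open>auto intro: koebe_field_differentiable koebe_uminus_field_differentiable\<close>)
  then show ?thesis by simp
qed

text \<open>The test family moves only the last mark, at nonzero speed.\<close>

lemma not_etale: "\<not> etale_at 0 4 sphere_fam (vec1 t0)"
proof
  assume etale: "etale_at 0 4 sphere_fam (vec1 t0)"
  \<comment> \<open>The test family lives over all of \<open>base1\<close>, so its marks must stay
    distinct there. Since |t - t0| < 3/2, speed 1/10 moves the imaginary part by less than 3/20 from
    its initial 6/25, which keeps the moving mark in the upper half plane, away from the other two
    finite marks.\<close>
  define g where "g t = koebe t0 + (t - t0) / 10" for t
  define \<mu> where "\<mu> = (\<lambda>j s. glued (s, [None, Some (- (8/7)), Some (koebe (- t0)), Some (g (s 0))] ! j))"
  have fam: "family 0 4 (sphere_fam\<lparr>mark := \<mu>\<rparr>)"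
  proof (rule family_sphere_fam_finite_marks[of _ "\<lambda>_. - (8/7)" "\<lambda>_. koebe (- t0)" g])
    fix t :: complex assume t: "0 < norm t" "norm t < 1"
    have "norm (t - t0) < 3/2" using norm_triangle_ineq4[of t t0] t norm_t0 by linarith
    then have "\<bar>Im (t - t0)\<bar> < 3/2" using abs_Im_le_cmod[of "t - t0"] by linarith
    moreover have "Im (g t) = 6 / 25 + Im (t - t0) / 10" by (simp add: g_def koebe_t0)
    ultimately have "Im (g t) > 0" by linarith
    moreover have "koebe (- t0) \<noteq> - (8/7)" by (rule koebe_neq_mark) (simp add: norm_t0)
    moreover have "Im (- (8/7)) = 0" "Im (koebe (- t0)) < 0" by (simp_all add: koebe_t0)
    ultimately show "- (8/7) \<noteq> koebe (- t0) \<and> - (8/7) \<noteq> g t \<and> koebe (- t0) \<noteq> g t"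
      by (metis less_irrefl less_trans)
    show "(\<lambda>_. - (8/7)) field_differentiable at t \<and> (\<lambda>_. koebe (- t0)) field_differentiable at t \<and> g field_differentiable at t"
      unfolding g_def[abs_def] by (auto intro!: derivative_intros field_differentiable_divide)
  qed (simp add: \<mu>_def)
  have b: "vec1 t0 \<in> base1" by (simp add: vec1_base1_iff norm_t0)
  \<comment> \<open>Over \<open>t0\<close> the two families carry the same marks, because
    \<open>g t0\<close> equals \<open>koebe t0\<close>.\<close>
  have "fibre_iso 4 (sphere_fam\<lparr>mark := \<mu>\<rparr>) (vec1 t0) sphere_fam (vec1 t0) id"
    by (rule fibre_iso_id[OF b]) (simp add: \<mu>_def mark_sphere_fam[OF b] g_def)
  then obtain S f \<Phi> where ls: "local_section 4 (sphere_fam\<lparr>mark := \<mu>\<rparr>) (vec1 t0) sphere_fam (vec1 t0) id S f \<Phi>"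
    using etale fam b unfolding etale_at_def by (metis sphere_fam_simps(2) mark_update_simps(5))
  then have arrow: "family_arrow 4 (sphere_fam\<lparr>mark := \<mu>\<rparr>) S sphere_fam f \<Phi>" and f0: "f (vec1 t0) = vec1 t0"
    and S: "openin (top_of_set base1) S" "vec1 t0 \<in> S"
    by (auto simp: local_section_def)
  have "openin (top_of_set (Cn (Suc 0))) base1" using fam by (simp add: family_def)
  then have "openin (top_of_set (Cn (Suc 0))) S" using S(1) openin_trans by blast
  then obtain M where M: "open M" "S = vec1 ` M" by (auto simp: openin_Cn_1_iff)
  have Sb: "S \<subseteq> base1" using S(1) openin_imp_subset by blast
  have tM: "t0 \<in> M" using S(2) M(2) by auto
  define q where "q = (\<lambda>t. f (vec1 t) 0)"
  have q0: "q t0 = t0" by (simp add: q_def f0)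
  have "(\<lambda>u. f ((vec1 t0)(0 := u)) 0) field_differentiable at (vec1 t0 0)"
    using arrow S(2) unfolding family_arrow_def holo_def by fastforce
  then have "q field_differentiable at t0" by (simp add: q_def)
  then obtain q' where "(q has_field_derivative q') (at t0)" by (auto simp: field_differentiable_def)
  \<comment> \<open>Whatever the derivative of the classifying map \<open>q\<close>, the vanishing
    derivative of \<open>modulus\<close> at \<open>q t0 = t0\<close> kills it.\<close>
  then have d0: "((\<lambda>t. modulus (q t)) has_field_derivative 0 * q') (at t0)"
    using DERIV_chain2[of modulus 0 q t0 q' UNIV] modulus_critical q0 by simp
  define e where "e = koebe (- t0) + 8/7"
  have e: "e \<noteq> 0" unfolding e_def using koebe_neq_mark[of "- t0"] norm_t0 by (simp add: eq_neg_iff_add_eq_0)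
  \<comment> \<open>The scale factor \<open>c\<close> cancels, so near \<open>t0\<close> the
    composite is an explicit affine function of t, whose slope 1 / (10 e) is not zero.\<close>
  have eq: "modulus (q t) = (g t + 8/7) / e" if t: "t \<in> M" for t
  proof -
    have tb: "vec1 t \<in> S" "vec1 t \<in> base1" using t M(2) Sb by auto
    obtain c where "c \<noteq> 0" "koebe (- q t) = - (8/7) + c * (koebe (- t0) + 8/7)" "koebe (q t) = - (8/7) + c * (g t + 8/7)"
      by (rule family_arrow_affine[OF arrow tb, of "koebe (- t0)" "g t"]) (auto simp: \<mu>_def q_def)
    then show ?thesis by (simp add: modulus_def e_def)
  qed
  have ev: "\<forall>\<^sub>F t in nhds t0. (g t + 8/7) / e = modulus (q t)"
    using eventually_nhds_in_open[OF M(1) tM] by eventually_elim (simp add: eq)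
  have "((\<lambda>t. (g t + 8/7) / e) has_field_derivative (1 / 10) / e) (at t0)"
    unfolding g_def using e by (auto intro!: derivative_eq_intros)
  then have "((\<lambda>t. modulus (q t)) has_field_derivative (1 / 10) / e) (at t0)"
    by (rule DERIV_cong_ev[OF refl ev refl, THEN iffD1])
  then have "(1 / 10) / e = 0 * q'" using d0 DERIV_unique by blast
  then show False using e by simp
qed

text \<open>Having \<open>family g n\<close> for the plumbing family as a conjunct ensures that the
  failure concerns a genuine object over the punctured polydisc and is not an artefact of a
  malformed family.\<close>

theorem mainTheorem1:
  shows "\<exists>(g :: nat) (n :: nat) (X0 :: nodal_surface)
            (z :: nat \<Rightarrow> complex \<Rightarrow> cpoint) (w :: nat \<Rightarrow> complex \<Rightarrow> cpoint).
           maximally_degenerate g n X0 \<and>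
           local_coordinates g n X0 z w \<and>
           disjointness_property g n z w \<and>
           family g n (plumbing_family g n X0 z w) \<and>
           (\<exists>t \<in> punctured_polydisc (num_nodes g n).
              \<not> etale_at g n (plumbing_family g n X0 z w) t)"
proof (intro exI conjI bexI)
  show "maximally_degenerate 0 4 two_spheres" by (rule maximally_degenerate_two_spheres)
  show "local_coordinates 0 4 two_spheres z_coord w_coord" by (rule local_coordinates_two_spheres)
  show "disjointness_property 0 4 z_coord w_coord" by (rule disjointness_property_two_spheres)
  show "family 0 4 (plumbing_family 0 4 two_spheres z_coord w_coord)"
    using family_plumbing unfolding sphere_fam_def .
  show "\<not> etale_at 0 4 (plumbing_family 0 4 two_spheres z_coord w_coord) (vec1 t0)"
    using not_etale unfolding sphere_fam_def .
  show "vec1 t0 \<in> punctured_polydisc (num_nodes 0 4)"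
    by (simp add: vec1_base1_iff norm_t0)
qed

end
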